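(* Let $u_h^n\in X_h$, $1\le n\le KN$, be the solution of the fully discrete finite element scheme described in the context, with starting values $u_h^n\in X_h$, $-N\le n\le0$, and let $c=\sup_{0\le k\le N}\|u_h^{k-N}\|_0$. Then for $1\le n\le KN$, $$\|u_h^n\|_0\le 2E_\alpha\big(2^{\alpha+1}\Lambda t_n^\alpha\big)\Big(\|u_h^0\|_0+\frac{2^\alpha t_n^\alpha}{\Gamma(1+\alpha)}\max_{1\le k\le n}y^k\Big),$$ where: if $1\le n\le N$, then $$\Lambda=0,\qquad y^k=|b|\Big(\rho^{1-\alpha}+\frac{t_k^{1-\alpha}}{\Gamma(2-\alpha)}\Big)\big(c+\|\varphi(-\tau)\|_0\big)+\|F^k\|_0;$$ and if $N+1\le n\le KN$, then $$\Lambda=|b|\Big(\rho^{1-\alpha}+\frac{(K\tau)^{1-\alpha}}{\Gamma(2-\alpha)}\Big),\qquad y^k=c|b|\rho\sum_{j=0}^NA_{k-j}+|b|\,\|H^k\|_0+\|F^k\|_0.$$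
   Context: Data. $0<\alpha<1$, $\Omega=(0,L)$ with $L>0$, constants $p\ge0$, $a\le0$, $b\ne0$, delay $\tau>0$, $K$ a positive integer; $f$ is a continuous source, $\varphi$ a continuous initial function on $\bar\Omega\times[-\tau,0]$ (with a time derivative $\partial_t\varphi(x,0)$ at $t=0$), for the problem $\partial_tu=\partial_t^{1-\alpha}(p\Delta u+au)+bu(x,t-\tau)+f$ on $\Omega\times(0,K\tau]$, $u=\varphi$ for $t\in[-\tau,0]$, $u=0$ on $\partial\Omega$ (with $\partial_t^{1-\alpha}$ the Riemann–Liouville derivative). $(\cdot,\cdot)$ and $\|\cdot\|_0$ are the inner product and norm of $L^2(0,L)$. $E_\alpha(z)=\sum_{j\ge0}z^j/\Gamma(j\alpha+1)$. $\varphi(t)$ denotes $\varphi(\cdot,t)$. Discretization. $N$ is a positive integer, $\rho=\tau/N$, $t_n=n\rho$ for $-N\le n\le KN$. $X_h\subset H_0^1(\Omega)$ is the continuous piecewise linear finite element space on a quasi-uniform partition of $\Omega$ of maximum diameter $h$. Let $A_k=\rho^{-\alpha}\frac{\Gamma(k+1-\alpha)}{\Gamma(1-\alpha)\Gamma(k+1)}$ for $k\ge0$, and $A_k=0$ for $k<0$. Let $g_k^{(\beta)}=(-1)^k\binom{\beta}{k}$. For a sequence $v^n$ define $$\bar\partial_\rho^\alpha v^n=\sum_{k=1}^nA_{n-k}(v^k-v^{k-1}),\qquad J^{1-\alpha}v^{n-N}=\rho^{1-\alpha}\sum_{k=0}^ng_{n-k}^{(\alpha-1)}v^{k-N}=\rho\sum_{k=0}^nA_kv^{n-N-k}.$$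 Further, $$H^n=\partial_t\varphi(0)\,\rho^{1-\alpha}\sum_{k=N}^ng_{n-k}^{(\alpha-1)}(t_k-\tau)-\varphi(-\tau)\,\rho^{1-\alpha}\sum_{k=0}^ng_{n-k}^{(\alpha-1)}$$ (an empty sum is $0$), $\tilde f(x,t)=\int_0^t\frac{(t-s)^{-\alpha}}{\Gamma(1-\alpha)}f(x,s)\,ds$, $\tilde f^n=\tilde f(\cdot,t_n)$, and $$F^n=\tilde f^n+b\frac{t_n^{1-\alpha}}{\Gamma(2-\alpha)}\varphi(\cdot,-\tau)\ \text{ if }t_n\le\tau,\qquad F^n=\tilde f^n-b\Big[\frac{(t_n-\tau)^{2-\alpha}}{\Gamma(3-\alpha)}\partial_t\varphi(\cdot,0)-\frac{t_n^{1-\alpha}}{\Gamma(2-\alpha)}\varphi(\cdot,-\tau)\Big]\ \text{ if }t_n>\tau.$$ Scheme. Given $u_h^n\in X_h$ for $-N\le n\le0$ (approximations of $\varphi(t_n)$), find $u_h^n\in X_h$, $n=1,\dots,KN$, such that for all $v_h\in X_h$ $$\big(\bar\partial_\rho^\alpha u_h^n,v_h\big)=-p(\nabla u_h^n,\nabla v_h)+a(u_h^n,v_h)+b\big(J^{1-\alpha}u_h^{n-N},v_h\big)+b(H^n,v_h)+(F^n,v_h).$$ *)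

theory Defs
  imports "HOL-Analysis.Analysis"
begin

text \<open>
  Functions on the interval \<open>(0, L)\<close> are total functions \<open>real \<Rightarrow> real\<close> whose values outside
  \<open>[0, L]\<close> are irrelevant. Time levels are integers, since the delay makes the
  negative levels \<open>-N, \<dots>, 0\<close> part of the data.
\<close>

subsection \<open>The space \<open>L\<^sup>2(0, L)\<close>\<close>

definition in_L2 :: "real \<Rightarrow> (real \<Rightarrow> real) \<Rightarrow> bool" where
  "in_L2 L v \<longleftrightarrow> set_borel_measurable lborel {0<..<L} v
     \<and> set_integrable lborel {0<..<L} (\<lambda>x. (v x)\<^sup>2)"

definition inner_L2 :: "real \<Rightarrow> (real \<Rightarrow> real) \<Rightarrow> (real \<Rightarrow> real) \<Rightarrow> real" where
  "inner_L2 L v w = (LBINT x:{0<..<L}. v x * w x)"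

definition norm_L2 :: "real \<Rightarrow> (real \<Rightarrow> real) \<Rightarrow> real" where
  "norm_L2 L v = sqrt (inner_L2 L v v)"

subsection \<open>The finite element space\<close>

definition partition_width :: "nat \<Rightarrow> (nat \<Rightarrow> real) \<Rightarrow> real" where
  "partition_width M x = Max ((\<lambda>i. x (Suc i) - x i) ` {..<M})"

text \<open>
  A partition \<open>0 = x\<^sub>0 < \<dots> < x\<^sub>M = L\<close> of maximum diameter \<open>h\<close>, quasi-uniform with constant \<open>\<sigma>\<close>.
\<close>

definition quasi_uniform_partition ::
  "real \<Rightarrow> real \<Rightarrow> real \<Rightarrow> nat \<Rightarrow> (nat \<Rightarrow> real) \<Rightarrow> bool" where
  "quasi_uniform_partition L \<sigma> h M x \<longleftrightarrow>
     1 \<le> M \<and> x 0 = 0 \<and> x M = L \<and> (\<forall>i<M. x i < x (Suc i))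
     \<and> h = partition_width M x \<and> (\<forall>i<M. h \<le> \<sigma> * (x (Suc i) - x i))"

definition fe_space :: "real \<Rightarrow> nat \<Rightarrow> (nat \<Rightarrow> real) \<Rightarrow> (real \<Rightarrow> real) set" where
  "fe_space L M x =
     {v. continuous_on {0..L} v \<and> v 0 = 0 \<and> v L = 0
       \<and> (\<forall>i<M. \<exists>c d. \<forall>y\<in>{x i..x (Suc i)}. v y = c + d * y)}"

text \<open>
  For \<open>v\<close> in the finite element space the weak gradient is represented by \<^term>\<open>deriv v\<close>, which
  is the classical derivative except at the finitely many nodes, where its value is immaterial.
\<close>

subsection \<open>Discrete fractional operators\<close>

definition mittag_leffler :: "real \<Rightarrow> real \<Rightarrow> real" where
  "mittag_leffler \<alpha> z = (\<Sum>j. z ^ j / Gamma (real j * \<alpha> + 1))"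

definition A_coeff :: "real \<Rightarrow> real \<Rightarrow> int \<Rightarrow> real" where
  "A_coeff \<alpha> \<rho> k =
     (if k < 0 then 0
      else \<rho> powr (-\<alpha>) * (Gamma (of_int k + 1 - \<alpha>) / (Gamma (1 - \<alpha>) * Gamma (of_int k + 1))))"

definition g_coeff :: "real \<Rightarrow> nat \<Rightarrow> real" where
  "g_coeff \<beta> k = (-1) ^ k * (\<beta> gchoose k)"

definition frac_diff :: "real \<Rightarrow> real \<Rightarrow> (int \<Rightarrow> real) \<Rightarrow> int \<Rightarrow> real" where
  "frac_diff \<alpha> \<rho> v n = (\<Sum>k = 1..n. A_coeff \<alpha> \<rho> (n - k) * (v k - v (k - 1)))"

text \<open>
  \<open>frac_int \<alpha> \<rho> N v m\<close> is \<open>J\<^sup>1\<^sup>-\<^sup>\<alpha> v\<^sup>m\<close>, the convolution quadrature starting at level \<open>-N\<close>;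
  the scheme uses it with \<open>m = n - N\<close>.
\<close>

definition frac_int :: "real \<Rightarrow> real \<Rightarrow> int \<Rightarrow> (int \<Rightarrow> real) \<Rightarrow> int \<Rightarrow> real" where
  "frac_int \<alpha> \<rho> N v m =
     \<rho> powr (1 - \<alpha>) * (\<Sum>k = 0..m + N. g_coeff (\<alpha> - 1) (nat (m + N - k)) * v (k - N))"

lemma g_coeff_eq_A_coeff:
  assumes "0 < \<alpha>" "\<alpha> < 1" "0 < \<rho>"
  shows "\<rho> powr (1 - \<alpha>) * g_coeff (\<alpha> - 1) k = \<rho> * A_coeff \<alpha> \<rho> (int k)"
proof -
  have "1 - \<alpha> \<notin> \<int>\<^sub>\<le>\<^sub>0"
    using assms by (auto elim!: nonpos_Ints_cases)
  then have "pochhammer (1 - \<alpha>) k = Gamma (1 - \<alpha> + real k) / Gamma (1 - \<alpha>)"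
    by (rule pochhammer_Gamma)
  moreover have "g_coeff (\<alpha> - 1) k = pochhammer (1 - \<alpha>) k / fact k"
    by (simp add: g_coeff_def gbinomial_pochhammer power_mult_distrib [symmetric])
  moreover have "\<rho> powr (1 - \<alpha>) = \<rho> * \<rho> powr (- \<alpha>)"
    using assms by (simp add: powr_diff powr_minus divide_inverse)
  moreover have "Gamma (real k + 1) = fact k"
    by (metis Gamma_fact add.commute)
  ultimately show ?thesis
    by (simp add: A_coeff_def algebra_simps)
qed

lemma frac_int_eq_A_coeff:
  assumes "0 < \<alpha>" "\<alpha> < 1" "0 < \<rho>"
  shows "frac_int \<alpha> \<rho> N v (n - N) = \<rho> * (\<Sum>k = 0..n. A_coeff \<alpha> \<rho> k * v (n - N - k))"
proof -
  have "frac_int \<alpha> \<rho> N v (n - N) =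
      (\<Sum>k = 0..n. (\<rho> powr (1 - \<alpha>) * g_coeff (\<alpha> - 1) (nat (n - k))) * v (k - N))"
    by (simp add: frac_int_def sum_distrib_left mult.assoc)
  also have "\<dots> = (\<Sum>k = 0..n. \<rho> * A_coeff \<alpha> \<rho> (n - k) * v (k - N))"
    by (intro sum.cong refl) (simp add: g_coeff_eq_A_coeff [OF assms])
  also have "\<dots> = (\<Sum>k = 0..n. \<rho> * A_coeff \<alpha> \<rho> k * v (n - N - k))"
    by (rule sum.reindex_bij_witness [of _ "\<lambda>k. n - k" "\<lambda>k. n - k"])
      (auto simp: algebra_simps)
  finally show ?thesis
    by (simp add: sum_distrib_left mult.assoc)
qed

subsection \<open>Data terms and the scheme\<close>

text \<open>
  Below, \<open>t\<^sub>n\<close> is \<open>of_int n * \<rho>\<close>, and \<open>\<phi>' x\<close> stands for \<open>\<partial>\<^sub>t\<phi>(x, 0)\<close>.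
\<close>

definition H_term ::
  "real \<Rightarrow> real \<Rightarrow> int \<Rightarrow> real \<Rightarrow> (real \<Rightarrow> real \<Rightarrow> real) \<Rightarrow> (real \<Rightarrow> real) \<Rightarrow> int \<Rightarrow> real \<Rightarrow> real" where
  "H_term \<alpha> \<rho> N \<tau> \<phi> \<phi>' n x =
     \<phi>' x * \<rho> powr (1 - \<alpha>)
        * (\<Sum>k = N..n. g_coeff (\<alpha> - 1) (nat (n - k)) * (of_int k * \<rho> - \<tau>))
     - \<phi> x (-\<tau>) * \<rho> powr (1 - \<alpha>) * (\<Sum>k = 0..n. g_coeff (\<alpha> - 1) (nat (n - k)))"

definition f_tilde :: "real \<Rightarrow> (real \<Rightarrow> real \<Rightarrow> real) \<Rightarrow> real \<Rightarrow> real \<Rightarrow> real" where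
  "f_tilde \<alpha> f x t = (LBINT s:{0..t}. (t - s) powr (-\<alpha>) / Gamma (1 - \<alpha>) * f x s)"

definition F_term ::
  "real \<Rightarrow> real \<Rightarrow> real \<Rightarrow> real \<Rightarrow> (real \<Rightarrow> real \<Rightarrow> real) \<Rightarrow> (real \<Rightarrow> real \<Rightarrow> real) \<Rightarrow> (real \<Rightarrow> real)
    \<Rightarrow> int \<Rightarrow> real \<Rightarrow> real" where
  "F_term \<alpha> \<rho> \<tau> b f \<phi> \<phi>' n x =
     (let t = of_int n * \<rho> in
      if t \<le> \<tau> then
        f_tilde \<alpha> f x t + b * (t powr (1 - \<alpha>) / Gamma (2 - \<alpha>)) * \<phi> x (-\<tau>)
      else
        f_tilde \<alpha> f x t
          - b * ((t - \<tau>) powr (2 - \<alpha>) / Gamma (3 - \<alpha>) * \<phi>' x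
                 - t powr (1 - \<alpha>) / Gamma (2 - \<alpha>) * \<phi> x (-\<tau>)))"

definition fe_scheme ::
  "real \<Rightarrow> real \<Rightarrow> real \<Rightarrow> real \<Rightarrow> real \<Rightarrow> real \<Rightarrow> int \<Rightarrow> int
    \<Rightarrow> (real \<Rightarrow> real \<Rightarrow> real) \<Rightarrow> (real \<Rightarrow> real \<Rightarrow> real) \<Rightarrow> (real \<Rightarrow> real)
    \<Rightarrow> (real \<Rightarrow> real) set \<Rightarrow> (int \<Rightarrow> real \<Rightarrow> real) \<Rightarrow> bool" where
  "fe_scheme \<alpha> L p a b \<tau> N K f \<phi> \<phi>' X u \<longleftrightarrow>
     (let \<rho> = \<tau> / of_int N in
      (\<forall>n\<in>{-N..K * N}. u n \<in> X) \<and>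
      (\<forall>n\<in>{1..K * N}. \<forall>v\<in>X.
         inner_L2 L (\<lambda>x. frac_diff \<alpha> \<rho> (\<lambda>k. u k x) n) v =
           - p * inner_L2 L (deriv (u n)) (deriv v)
           + a * inner_L2 L (u n) v
           + b * inner_L2 L (\<lambda>x. frac_int \<alpha> \<rho> N (\<lambda>k. u k x) (n - N)) v
           + b * inner_L2 L (H_term \<alpha> \<rho> N \<tau> \<phi> \<phi>' n) v
           + inner_L2 L (F_term \<alpha> \<rho> \<tau> b f \<phi> \<phi>' n) v))"

end

theory Submission
  imports Defs "HOL-Real_Asymp.Real_Asymp"
begin

text \<open>
  Testing the scheme with \<open>v\<^sub>h = u\<^sub>h\<^sup>n\<close> drops the gradient and reaction terms, and since the weights
  \<open>A\<^sub>k\<close> are positive and decreasing, the norms \<open>w\<^sub>n\<close> of \<open>u\<^sub>h\<^sup>n\<close> satisfy the same scalar fractional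
  difference inequality, with right-hand side at most \<open>\<Lambda> max\<^sub>i\<^sub><\<^sub>n w\<^sub>i + y\<^sup>n\<close>: the delay \<open>N \<ge> 1\<close> makes
  the unknown enter explicitly. As \<open>A\<^sub>k\<close> has generating function \<open>\<rho>^(-\<alpha>) (1 - z)^(\<alpha> - 1)\<close>, the difference
  is inverted exactly by the coefficients of \<open>\<rho>^\<alpha> (1 - z)^(-\<alpha>)\<close>, by the Vandermonde identity.
  Iterating the resulting Volterra inequality produces a sum of terms
  \<open>(\<Lambda> \<rho>^\<alpha>)^j \<Gamma>(n - j + j \<alpha>) / (\<Gamma>(1 + j \<alpha>) \<Gamma>(n - j))\<close>, and \<open>\<Gamma>(m + s) \<le> (m + s)^s \<Gamma>(m)\<close>
  bounds them by the terms of \<open>E\<^sub>\<alpha>(\<Lambda> t\<^sub>n^\<alpha>)\<close>.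
\<close>

subsection \<open>Gamma and Mittag-Leffler functions\<close>

lemma Gamma_plus1_pos: "0 < x \<Longrightarrow> Gamma (x + 1) = x * Gamma (x :: real)"
  by (rule Gamma_plus1) (auto elim!: nonpos_Ints_cases)

lemma Gamma_pos_neq_0 [simp]: "0 < x \<Longrightarrow> Gamma (x :: real) \<noteq> 0"
  using Gamma_real_pos[of x] by linarith

text \<open>Log-convexity of Gamma: \<open>x + s\<close> is a convex combination of \<open>x\<close>
  and \<open>x + 1\<close>, and \<open>Gamma (x + 1) = x * Gamma x\<close>.\<close>

lemma Gamma_add_le_powr:
  fixes x s :: real
  assumes "0 < x" "0 \<le> s" "s \<le> 1"
  shows "Gamma (x + s) \<le> x powr s * Gamma x"
proof -
  have "ln (Gamma ((1 - s) *\<^sub>R x + s *\<^sub>R (x + 1))) \<le> (1 - s) * ln (Gamma x) + s * ln (Gamma (x + 1))"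
    using convex_onD[OF log_convex_Gamma_real, of s x "x + 1"] assms by simp
  moreover have "(1 - s) *\<^sub>R x + s *\<^sub>R (x + 1) = x + s"
    by (simp add: algebra_simps)
  moreover have "ln (Gamma (x + 1)) = ln x + ln (Gamma x)"
    using assms by (simp add: Gamma_plus1_pos ln_mult)
  ultimately have "ln (Gamma (x + s)) \<le> s * ln x + ln (Gamma x)"
    by (simp add: algebra_simps)
  also have "\<dots> = ln (x powr s * Gamma x)"
    using assms by (simp add: ln_mult)
  finally show ?thesis
    using assms by simp
qed

text \<open>The functional equation gives one factor, at most \<open>x + s\<close>, for each unit
  contained in \<open>s\<close>; log-convexity covers the remaining fraction.\<close>

lemma Gamma_add_le_add_powr:
  fixes x s :: real
  assumes "0 < x" "0 \<le> s"
  shows "Gamma (x + s) \<le> (x + s) powr s * Gamma x"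
proof -
  have nat_step: "Gamma (x + real k) \<le> (x + real k) ^ k * Gamma x" for k
  proof (induction k)
    case (Suc k)
    have "Gamma (x + real (Suc k)) = (x + real k) * Gamma (x + real k)"
      using assms Gamma_plus1_pos[of "x + real k"] by (simp add: add_ac)
    also have "\<dots> \<le> (x + real k) * ((x + real k) ^ k * Gamma x)"
      using assms Suc by (intro mult_left_mono) auto
    also have "\<dots> = (x + real k) ^ Suc k * Gamma x" by simp
    also have "\<dots> \<le> (x + real (Suc k)) ^ Suc k * Gamma x"
      using assms by (intro mult_right_mono power_mono) (auto simp: less_imp_le)
    finally show ?case .
  qed simp
  define k where "k = nat \<lfloor>s\<rfloor>"
  define r where "r = s - real k"
  have r: "0 \<le> r" "r \<le> 1" "s = real k + r"
    using assms unfolding r_def k_def by (auto simp: of_nat_nat) linarith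
  have "Gamma (x + s) = Gamma ((x + real k) + r)"
    by (simp add: r(3) add_ac)
  also have "\<dots> \<le> (x + real k) powr r * Gamma (x + real k)"
    using assms r by (intro Gamma_add_le_powr) auto
  also have "\<dots> \<le> (x + real k) powr r * ((x + real k) powr real k * Gamma x)"
    using assms nat_step[of k] by (intro mult_left_mono) (auto simp: powr_realpow)
  also have "\<dots> = (x + real k) powr s * Gamma x"
    by (simp add: r(3) powr_add mult_ac)
  also have "\<dots> \<le> (x + s) powr s * Gamma x"
    using assms r by (intro mult_right_mono powr_mono2) (auto simp: less_imp_le)
  finally show ?thesis .
qed

text \<open>Ratio test: log-convexity over the step from \<open>x + \<alpha>\<close> to
  \<open>x + 1\<close> forces \<open>Gamma x / Gamma (x + \<alpha>)\<close> to tend to 0.\<close>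

lemma summable_mittag_leffler:
  fixes \<alpha> z :: real
  assumes "0 < \<alpha>" "\<alpha> < 1"
  shows "summable (\<lambda>j. z ^ j / Gamma (real j * \<alpha> + 1))"
proof -
  have lim: "filterlim (\<lambda>j. (real j * \<alpha> + 1 + \<alpha>) powr \<alpha>) at_top sequentially"
    using assms by real_asymp
  \<comment> \<open>The factor \<open>1 + \<alpha>\<close> pays for
    \<open>x + \<alpha> \<le> x * (1 + \<alpha>)\<close>, the other factors for the ratio
    \<open>1/2\<close>.\<close>
  define C where "C = 2 * (1 + \<alpha>) * (\<bar>z\<bar> + 1)"
  obtain m where m: "\<And>j. j \<ge> m \<Longrightarrow> C \<le> (real j * \<alpha> + 1 + \<alpha>) powr \<alpha>"
    using lim unfolding filterlim_at_top eventually_sequentially by blast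
  show ?thesis
  proof (rule summable_ratio_test[of "1/2" m])
    fix j assume j: "j \<ge> m"
    define x where "x = real j * \<alpha> + 1"
    have x: "x \<ge> 1" using assms by (simp add: x_def)
    have "x * Gamma x = Gamma ((x + \<alpha>) + (1 - \<alpha>))"
      using x Gamma_plus1_pos[of x] by (simp add: add_ac)
    also have "\<dots> \<le> (x + \<alpha>) powr (1 - \<alpha>) * Gamma (x + \<alpha>)"
      using assms x by (intro Gamma_add_le_powr) auto
    also have "\<dots> = (x + \<alpha>) * Gamma (x + \<alpha>) / (x + \<alpha>) powr \<alpha>"
      using assms x by (simp add: powr_diff)
    finally have 1: "x * Gamma x * (x + \<alpha>) powr \<alpha> \<le> (x + \<alpha>) * Gamma (x + \<alpha>)"
      using assms x by (simp add: field_simps)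
    have Gx: "Gamma x > 0" "Gamma (x + \<alpha>) > 0" using x assms by auto
    have "x * Gamma x * C \<le> x * Gamma x * (x + \<alpha>) powr \<alpha>"
      using m[OF j] x Gx by (intro mult_left_mono) (auto simp: x_def)
    also have "\<dots> \<le> (x + \<alpha>) * Gamma (x + \<alpha>)" by (rule 1)
    also have "\<dots> \<le> (x * (1 + \<alpha>)) * Gamma (x + \<alpha>)"
      using x assms Gx by (intro mult_right_mono) (auto simp: algebra_simps)
    finally have "x * ((1 + \<alpha>) * (2 * (\<bar>z\<bar> + 1) * Gamma x)) \<le> x * ((1 + \<alpha>) * Gamma (x + \<alpha>))"
      by (simp add: C_def algebra_simps)
    then have "2 * (\<bar>z\<bar> + 1) * Gamma x \<le> Gamma (x + \<alpha>)"
      using x assms by simp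
    then have 2: "2 * \<bar>z\<bar> * Gamma x \<le> Gamma (x + \<alpha>)"
      using Gx by (simp add: algebra_simps)
    have "norm (z ^ Suc j / Gamma (real (Suc j) * \<alpha> + 1)) = \<bar>z\<bar> ^ j * (\<bar>z\<bar> / Gamma (x + \<alpha>))"
      using Gx by (simp add: x_def algebra_simps abs_mult power_abs)
    also have "\<dots> \<le> \<bar>z\<bar> ^ j * (1 / 2 / Gamma x)"
      using 2 Gx by (intro mult_left_mono) (auto simp: field_simps)
    also have "\<dots> = 1 / 2 * norm (z ^ j / Gamma (real j * \<alpha> + 1))"
      using Gx by (simp add: x_def power_abs)
    finally show "norm (z ^ Suc j / Gamma (real (Suc j) * \<alpha> + 1))
        \<le> 1 / 2 * norm (z ^ j / Gamma (real j * \<alpha> + 1))" .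
  qed simp
qed

lemma mittag_leffler_mono:
  assumes "0 < \<alpha>" "\<alpha> < 1" "0 \<le> z" "z \<le> z'"
  shows "mittag_leffler \<alpha> z \<le> mittag_leffler \<alpha> z'"
  unfolding mittag_leffler_def
  using assms
  by (intro suminf_le summable_mittag_leffler divide_right_mono power_mono)
     (auto intro!: Gamma_real_nonneg add_nonneg_pos)

lemma sum_le_mittag_leffler:
  assumes "0 < \<alpha>" "\<alpha> < 1" "0 \<le> z"
  shows "(\<Sum>j<n. z ^ j / Gamma (real j * \<alpha> + 1)) \<le> mittag_leffler \<alpha> z"
  unfolding mittag_leffler_def
  using assms
  by (intro sum_le_suminf summable_mittag_leffler)
     (auto intro!: divide_nonneg_pos Gamma_real_pos add_nonneg_pos)

lemma mittag_leffler_ge_1: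
  assumes "0 < \<alpha>" "\<alpha> < 1" "0 \<le> z"
  shows "1 \<le> mittag_leffler \<alpha> z"
  using sum_le_mittag_leffler[OF assms, of 1] by simp

subsection \<open>Fractional binomial weights and a discrete Gronwall inequality\<close>

lemma g_coeff_0 [simp]: "g_coeff \<beta> 0 = 1"
  by (simp add: g_coeff_def)

text \<open>\<open>g_coeff \<beta>\<close> lists the coefficients of \<open>(1 - z)^\<beta>\<close>.
  For a negative exponent the signs cancel and a rising factorial remains, from which positivity and
  monotonicity can be read off.\<close>

lemma g_coeff_uminus: "g_coeff (- c) k = pochhammer c k / fact k"
  by (simp add: g_coeff_def gbinomial_pochhammer power_mult_distrib [symmetric])

lemma g_coeff_uminus_Gamma:
  assumes "0 < c"
  shows "g_coeff (- c) k = Gamma (c + real k) / (Gamma c * Gamma (real k + 1))"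
proof -
  have "c \<notin> \<int>\<^sub>\<le>\<^sub>0"
    using assms by (auto elim!: nonpos_Ints_cases)
  then show ?thesis
    by (simp add: g_coeff_uminus pochhammer_Gamma Gamma_fact add.commute[of _ 1])
qed

lemma g_coeff_uminus_nonneg: "0 < c \<Longrightarrow> 0 \<le> g_coeff (- c) k"
  by (simp add: g_coeff_uminus pochhammer_nonneg)

text \<open>The quotient \<open>(c + k) / (k + 1)\<close> is at most 1 for \<open>c \<le> 1\<close>
  and at least 1 for \<open>c \<ge> 1\<close>; this decides the direction of monotonicity.\<close>

lemma g_coeff_uminus_Suc: "g_coeff (- c) (Suc k) = g_coeff (- c) k * ((c + real k) / (real k + 1))"
  by (simp add: g_coeff_uminus pochhammer_Suc field_simps)

lemma g_coeff_uminus_antimono: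
  assumes "0 < c" "c \<le> 1"
  shows "g_coeff (- c) (Suc k) \<le> g_coeff (- c) k"
  unfolding g_coeff_uminus_Suc
  using assms by (intro mult_right_le_one_le g_coeff_uminus_nonneg) (auto simp: field_simps)

lemma g_coeff_uminus_le_1:
  assumes "0 < c" "c \<le> 1"
  shows "g_coeff (- c) k \<le> 1"
  by (induction k) (use g_coeff_uminus_antimono[OF assms] in \<open>auto intro: order_trans\<close>)

lemma g_coeff_uminus_mono:
  assumes "1 \<le> c" "k \<le> l"
  shows "g_coeff (- c) k \<le> g_coeff (- c) l"
proof -
  have "g_coeff (- c) k * 1 \<le> g_coeff (- c) (Suc k)" for k
    unfolding g_coeff_uminus_Suc
    using assms by (intro mult_left_mono g_coeff_uminus_nonneg) (auto simp: field_simps)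
  then show ?thesis
    using assms(2) lift_Suc_mono_le[of "g_coeff (- c)"] by simp
qed

lemma g_coeff_minus_1 [simp]: "g_coeff (- 1) k = 1"
  by (simp add: g_coeff_uminus pochhammer_fact[symmetric])

text \<open>Vandermonde's identity, that is, \<open>(1 - z)^\<beta> (1 - z)^\<gamma> = (1 -
  z)^(\<beta> + \<gamma>)\<close>.\<close>

lemma g_coeff_convolution: "(\<Sum>i\<le>n. g_coeff \<beta> i * g_coeff \<gamma> (n - i)) = g_coeff (\<beta> + \<gamma>) n"
proof -
  have "(\<Sum>i\<le>n. g_coeff \<beta> i * g_coeff \<gamma> (n - i)) =
      (\<Sum>i\<le>n. (-1) ^ n * ((\<beta> gchoose i) * (\<gamma> gchoose (n - i))))"
  proof (intro sum.cong refl)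
    fix i assume "i \<in> {..n}"
    then have "(-1 :: real) ^ n = (-1) ^ i * (-1) ^ (n - i)"
      by (simp flip: power_add)
    then show "g_coeff \<beta> i * g_coeff \<gamma> (n - i) = (-1) ^ n * ((\<beta> gchoose i) * (\<gamma> gchoose (n - i)))"
      by (simp add: g_coeff_def)
  qed
  then show ?thesis
    by (simp add: g_coeff_def gbinomial_Vandermonde atMost_atLeast0 flip: sum_distrib_left)
qed

text \<open>Taking partial sums is multiplication by \<open>1 / (1 - z)\<close>, whose coefficients
  are all 1.\<close>

lemma sum_g_coeff: "(\<Sum>i\<le>n. g_coeff \<beta> i) = g_coeff (\<beta> - 1) n"
  using g_coeff_convolution[of \<beta> "-1" n] by simp

text \<open>At index \<open>n - 1\<close> the coefficient contains
  \<open>Gamma (n + s) / Gamma n\<close>, so log-convexity gives \<open>n powr s\<close> without a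
  shift of the base.\<close>

lemma g_coeff_le_powr:
  assumes "0 < s" "s \<le> 1" "1 \<le> n"
  shows "g_coeff (- (1 + s)) (n - 1) \<le> real n powr s / Gamma (1 + s)"
proof -
  have "g_coeff (- (1 + s)) (n - 1) = Gamma (real n + s) / (Gamma (1 + s) * Gamma (real n))"
    using assms by (subst g_coeff_uminus_Gamma) (auto simp: algebra_simps of_nat_diff)
  also have "\<dots> \<le> (real n powr s * Gamma (real n)) / (Gamma (1 + s) * Gamma (real n))"
    using assms by (intro divide_right_mono Gamma_add_le_powr) (auto intro!: mult_nonneg_nonneg less_imp_le)
  also have "\<dots> = real n powr s / Gamma (1 + s)"
    using assms Gamma_real_pos[of "real n"] by simp
  finally show ?thesis .
qed

text \<open>The last weight is at most 1; the others form a partial sum up to \<open>n - 1\<close>,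
  where the power bound applies. The split is the origin of the summand
  \<open>\<rho> powr (1 - \<alpha>)\<close> in \<open>\<Lambda>\<close> and
  \<open>y\<close>.\<close>

lemma sum_g_coeff_le:
  assumes "0 < \<alpha>" "\<alpha> < 1"
  shows "(\<Sum>i\<le>n. g_coeff (\<alpha> - 1) i) \<le> 1 + real n powr (1 - \<alpha>) / Gamma (2 - \<alpha>)"
proof (cases n)
  case (Suc m)
  have "(\<Sum>i\<le>n. g_coeff (\<alpha> - 1) i) = g_coeff (- (1 + (1 - \<alpha>))) (n - 1) + g_coeff (- (1 - \<alpha>)) n"
    by (simp add: Suc sum_g_coeff)
  also have "\<dots> \<le> real n powr (1 - \<alpha>) / Gamma (1 + (1 - \<alpha>)) + 1"
    using assms Suc by (intro add_mono g_coeff_le_powr g_coeff_uminus_le_1) auto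
  finally show ?thesis by (simp add: add.commute)
qed (use assms in simp)

text \<open>In generating functions:
  \<open>(1 - z)^(\<alpha> - 1) (1 - z)^(-\<alpha>) = (1 - z)^(-1)\<close>. When \<open>d\<close>
  consists of increments, the right-hand side telescopes.\<close>

lemma fractional_difference_inverse:
  "(\<Sum>i\<le>n. g_coeff (- \<alpha>) (n - i) * (\<Sum>l\<le>i. g_coeff (\<alpha> - 1) (i - l) * d l)) = (\<Sum>l\<le>n. d l)"
proof -
  define G where "G \<beta> = Abs_fps (g_coeff \<beta>)" for \<beta>
  have G: "G (\<alpha> - 1) * G (- \<alpha>) = G (- 1)"
    by (rule fps_ext) (simp add: G_def fps_mult_nth g_coeff_convolution flip: atMost_atLeast0)
  have "(Abs_fps d * G (\<alpha> - 1)) * G (- \<alpha>) = Abs_fps d * G (- 1)"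
    by (simp add: mult.assoc G)
  then have "fps_nth ((Abs_fps d * G (\<alpha> - 1)) * G (- \<alpha>)) n = fps_nth (Abs_fps d * G (- 1)) n"
    by (rule arg_cong)
  then show ?thesis
    unfolding fps_mult_nth G_def fps_nth_Abs_fps
    by (simp add: atMost_atLeast0 mult.commute)
qed

text \<open>
  Coefficients of \<open>\<Sum>j<n. \<kappa>^j z^(j+1) (1 - z)^(-1 - j \<alpha>)\<close>: the iterates of the Volterra operator
  \<open>v \<mapsto> \<kappa> z (1 - z)^(-\<alpha>) v\<close> applied to \<open>z / (1 - z)\<close>. The factor \<open>z^j\<close> is what the delay provides;
  without it the \<open>j\<close>-th term would not be dominated by the Mittag-Leffler one.
\<close>

definition delay_majorant :: "real \<Rightarrow> real \<Rightarrow> nat \<Rightarrow> nat \<Rightarrow> real" where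
  "delay_majorant \<alpha> \<kappa> n k =
     (\<Sum>j<n. \<kappa> ^ j * (if k \<le> j then 0 else g_coeff (- (1 + real j * \<alpha>)) (k - 1 - j)))"

text \<open>Summand \<open>j\<close> is 0 up to \<open>k = j\<close> and then runs through
  nondecreasing coefficients, as \<open>1 + j * \<alpha> \<ge> 1\<close>. The Gronwall induction
  uses this to bound all earlier values by the latest one.\<close>

lemma delay_majorant_mono:
  assumes "0 < \<alpha>" "0 \<le> \<kappa>" "k \<le> l"
  shows "delay_majorant \<alpha> \<kappa> n k \<le> delay_majorant \<alpha> \<kappa> n l"
  unfolding delay_majorant_def
  using assms
  by (intro sum_mono mult_left_mono)
     (auto intro!: g_coeff_uminus_mono g_coeff_uminus_nonneg add_pos_nonneg simp del: minus_add_distrib)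

lemma delay_majorant_nonneg:
  assumes "0 < \<alpha>" "0 \<le> \<kappa>"
  shows "0 \<le> delay_majorant \<alpha> \<kappa> n k"
  using delay_majorant_mono[OF assms, of 0 k n] by (simp add: delay_majorant_def)

text \<open>Exponents add under convolution, so the Volterra operator sends summand \<open>j\<close>
  to summand \<open>j + 1\<close>, and the sum reproduces itself up to its two ends.\<close>

lemma delay_majorant_recurrence:
  assumes "1 \<le> k" "k \<le> n"
  shows "delay_majorant \<alpha> \<kappa> n k =
    1 + \<kappa> * (\<Sum>i\<le>k - 1. g_coeff (- \<alpha>) (k - 1 - i) * delay_majorant \<alpha> \<kappa> n i)"
proof -
  define T where "T j k = (if k \<le> j then 0 else g_coeff (- (1 + real j * \<alpha>)) (k - 1 - j))" for j k
  have step: "(\<Sum>i\<le>k - 1. g_coeff (- \<alpha>) (k - 1 - i) * T j i) = T (Suc j) k" for j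
  proof (cases "k \<le> Suc j")
    case True
    then have "(\<Sum>i\<le>k - 1. g_coeff (- \<alpha>) (k - 1 - i) * T j i) = 0"
      by (intro sum.neutral) (auto simp: T_def)
    then show ?thesis using True by (simp add: T_def)
  next
    case False
    \<comment> \<open>After the \<open>j + 1\<close> leading zeros of \<open>T j\<close>, the
      indices up to \<open>k - 1\<close> leave a convolution of degree \<open>m\<close>.\<close>
    define m where "m = k - 2 - j"
    have k: "k = m + 2 + j" using False by (simp add: m_def)
    have "(\<Sum>i\<le>k - 1. g_coeff (- \<alpha>) (k - 1 - i) * T j i) =
        (\<Sum>i\<in>{Suc j..k - 1}. g_coeff (- \<alpha>) (k - 1 - i) * T j i)"
      by (intro sum.mono_neutral_right) (auto simp: T_def)
    also have "\<dots> = (\<Sum>l\<le>m. g_coeff (- (1 + real j * \<alpha>)) l * g_coeff (- \<alpha>) (m - l))"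
      by (rule sum.reindex_bij_witness[of _ "\<lambda>l. l + Suc j" "\<lambda>i. i - Suc j"])
         (auto simp: T_def k)
    also have "\<dots> = T (Suc j) k"
      unfolding g_coeff_convolution using False by (simp add: T_def m_def algebra_simps)
    finally show ?thesis .
  qed
  have "\<kappa> * (\<Sum>i\<le>k - 1. g_coeff (- \<alpha>) (k - 1 - i) * delay_majorant \<alpha> \<kappa> n i) =
      (\<Sum>i\<le>k - 1. \<Sum>j<n. \<kappa> ^ Suc j * (g_coeff (- \<alpha>) (k - 1 - i) * T j i))"
    unfolding delay_majorant_def T_def[symmetric]
    by (simp add: sum_distrib_left mult_ac)
  also have "\<dots> = (\<Sum>j<n. \<kappa> ^ Suc j * T (Suc j) k)"
    by (subst sum.swap) (simp only: step flip: sum_distrib_left)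
  also have "\<dots> = (\<Sum>j<Suc n. \<kappa> ^ j * T j k) - T 0 k"
    by (subst sum.lessThan_Suc_shift) simp
  \<comment> \<open>The extra summand \<open>j = n\<close> vanishes because
    \<open>k \<le> n\<close>, and \<open>T 0 k = 1\<close> because \<open>1 \<le> k\<close>.\<close>
  also have "\<dots> = delay_majorant \<alpha> \<kappa> n k - 1"
    using assms by (simp add: delay_majorant_def T_def)
  finally show ?thesis by simp
qed

text \<open>Termwise, with \<open>x = n - j\<close> and \<open>s = j * \<alpha>\<close>, the Gamma
  quotient is at most \<open>(x + s) powr s\<close>. The delay takes \<open>j\<close> away while the
  exponent adds only \<open>j * \<alpha>\<close>, hence \<open>x + s \<le> n\<close>.\<close>

lemma delay_majorant_le_mittag_leffler:
  assumes "0 < \<alpha>" "\<alpha> < 1" "0 \<le> \<kappa>"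
  shows "delay_majorant \<alpha> \<kappa> n n \<le> mittag_leffler \<alpha> (\<kappa> * real n powr \<alpha>)"
proof -
  have "delay_majorant \<alpha> \<kappa> n n \<le> (\<Sum>j<n. (\<kappa> * real n powr \<alpha>) ^ j / Gamma (real j * \<alpha> + 1))"
    unfolding delay_majorant_def
  proof (intro sum_mono)
    fix j assume "j \<in> {..<n}"
    then have j: "j < n" by simp
    define s where "s = real j * \<alpha>"
    define x where "x = real (n - j)"
    have x: "x \<ge> 1" and s: "s \<ge> 0" using j assms by (auto simp: x_def s_def)
    have xs: "x + s \<le> real n"
      using j assms mult_left_mono[of \<alpha> 1 "real j"] by (simp add: x_def s_def)
    have "g_coeff (- (1 + s)) (n - 1 - j) = Gamma (x + s) / (Gamma (s + 1) * Gamma x)"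
      using j s by (subst g_coeff_uminus_Gamma) (auto simp: x_def algebra_simps of_nat_diff)
    also have "\<dots> \<le> ((x + s) powr s * Gamma x) / (Gamma (s + 1) * Gamma x)"
      using x s by (intro divide_right_mono Gamma_add_le_add_powr) (auto intro!: mult_nonneg_nonneg less_imp_le)
    also have "\<dots> = (x + s) powr s / Gamma (s + 1)"
      using x Gamma_real_pos[of x] by simp
    also have "\<dots> \<le> real n powr s / Gamma (s + 1)"
      using x s xs by (intro divide_right_mono powr_mono2) (auto intro!: less_imp_le)
    finally have "\<kappa> ^ j * g_coeff (- (1 + s)) (n - 1 - j) \<le> \<kappa> ^ j * (real n powr s / Gamma (s + 1))"
      using assms by (intro mult_left_mono) auto
    also have "real n powr s = (real n powr \<alpha>) ^ j"
      using j by (simp add: s_def powr_powr mult.commute flip: powr_realpow)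
    finally show "\<kappa> ^ j * (if n \<le> j then 0 else g_coeff (- (1 + real j * \<alpha>)) (n - 1 - j))
        \<le> (\<kappa> * real n powr \<alpha>) ^ j / Gamma (real j * \<alpha> + 1)"
      using j by (simp add: s_def power_mult_distrib)
  qed
  also have "\<dots> \<le> mittag_leffler \<alpha> (\<kappa> * real n powr \<alpha>)"
    using assms by (intro sum_le_mittag_leffler) auto
  finally show ?thesis .
qed

text \<open>By strong induction \<open>w k \<le> B * e k\<close>: the inverse weights recover
  \<open>w k - w 0\<close>, and the recurrence of the majorant absorbs the \<open>\<kappa>\<close>
  part. The arbitrary bound \<open>m\<close> stands in for a maximum, whose range would be empty at
  \<open>k = 0\<close>.\<close>

lemma discrete_fractional_gronwall:
  fixes w :: "nat \<Rightarrow> real"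
  assumes "0 < \<alpha>" "\<alpha> < 1" "0 \<le> \<kappa>" "0 \<le> \<eta>" "0 \<le> w 0" "1 \<le> n"
    and ineq: "\<And>k m. k < n \<Longrightarrow> 0 \<le> m \<Longrightarrow> (\<And>i. 1 \<le> i \<Longrightarrow> i \<le> k \<Longrightarrow> w i \<le> m) \<Longrightarrow>
      (\<Sum>i\<le>k. g_coeff (\<alpha> - 1) (k - i) * (w (Suc i) - w i)) \<le> \<kappa> * m + \<eta>"
  shows "w n \<le> mittag_leffler \<alpha> (\<kappa> * real n powr \<alpha>) * (w 0 + real n powr \<alpha> / Gamma (1 + \<alpha>) * \<eta>)"
proof -
  \<comment> \<open>\<open>B - w 0\<close> bounds the whole contribution of \<open>\<eta>\<close>;
    it will cancel the \<open>- B\<close> that the recurrence leaves.\<close>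
  define B where "B = w 0 + real n powr \<alpha> / Gamma (1 + \<alpha>) * \<eta>"
  define e where "e = delay_majorant \<alpha> \<kappa> n"
  have B: "B \<ge> 0"
    using assms by (auto simp: B_def intro!: add_nonneg_nonneg mult_nonneg_nonneg divide_nonneg_pos)
  have e0: "e k \<ge> 0" for k
    using assms unfolding e_def by (intro delay_majorant_nonneg)
  have main: "w k \<le> B * e k" if "1 \<le> k" "k \<le> n" for k
    using that
  proof (induction k rule: less_induct)
    case (less k)
    let ?D = "\<lambda>k. \<Sum>i\<le>k. g_coeff (\<alpha> - 1) (k - i) * (w (Suc i) - w i)"
    \<comment> \<open>The bound \<open>m\<close> is taken to be \<open>B * e i\<close>, which
      dominates all earlier \<open>w l\<close> by induction and monotonicity of
      \<open>e\<close>.\<close>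
    have D: "?D i \<le> \<kappa> * (B * e i) + \<eta>" if "i \<le> k - 1" for i
    proof (rule ineq)
      show "i < n" using that less.prems by simp
      show "0 \<le> B * e i" using B e0 by simp
      fix l assume l: "1 \<le> l" "l \<le> i"
      then have "w l \<le> B * e l" using less.prems that by (intro less.IH) auto
      also have "\<dots> \<le> B * e i"
        using B l assms unfolding e_def by (intro mult_left_mono delay_majorant_mono) auto
      finally show "w l \<le> B * e i" .
    qed
    have "w k - w 0 = (\<Sum>i\<le>k - 1. w (Suc i) - w i)"
      using less.prems sum_lessThan_telescope[of w k] lessThan_Suc_atMost[of "k - 1"] by simp
    also have "\<dots> = (\<Sum>i\<le>k - 1. g_coeff (- \<alpha>) (k - 1 - i) * ?D i)"
      by (rule fractional_difference_inverse[symmetric])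
    also have "\<dots> \<le> (\<Sum>i\<le>k - 1. g_coeff (- \<alpha>) (k - 1 - i) * (\<kappa> * (B * e i) + \<eta>))"
      using D assms by (intro sum_mono mult_left_mono g_coeff_uminus_nonneg) auto
    also have "\<dots> = B * (\<kappa> * (\<Sum>i\<le>k - 1. g_coeff (- \<alpha>) (k - 1 - i) * e i))
        + (\<Sum>i\<le>k - 1. g_coeff (- \<alpha>) (k - 1 - i)) * \<eta>"
      by (simp add: sum_distrib_left sum_distrib_right algebra_simps sum.distrib)
    also have "(\<Sum>i\<le>k - 1. g_coeff (- \<alpha>) (k - 1 - i)) = (\<Sum>i\<le>k - 1. g_coeff (- \<alpha>) i)"
      by (rule sum.reindex_bij_witness[of _ "\<lambda>i. k - 1 - i" "\<lambda>i. k - 1 - i"]) auto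
    also have "\<dots> = g_coeff (- (1 + \<alpha>)) (k - 1)"
      unfolding sum_g_coeff by (rule arg_cong2[where f = g_coeff]) simp_all
    also have "\<kappa> * (\<Sum>i\<le>k - 1. g_coeff (- \<alpha>) (k - 1 - i) * e i) = e k - 1"
      unfolding e_def using less.prems delay_majorant_recurrence[of k n \<alpha> \<kappa>] by simp
    finally have "w k - w 0 \<le> B * (e k - 1) + g_coeff (- (1 + \<alpha>)) (k - 1) * \<eta>" .
    moreover have "g_coeff (- (1 + \<alpha>)) (k - 1) * \<eta> \<le> real n powr \<alpha> / Gamma (1 + \<alpha>) * \<eta>"
    proof (intro mult_right_mono)
      have "g_coeff (- (1 + \<alpha>)) (k - 1) \<le> real k powr \<alpha> / Gamma (1 + \<alpha>)"
        using assms less.prems by (intro g_coeff_le_powr) auto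
      also have "\<dots> \<le> real n powr \<alpha> / Gamma (1 + \<alpha>)"
        using assms less.prems by (intro divide_right_mono powr_mono2) (auto intro!: less_imp_le)
      finally show "g_coeff (- (1 + \<alpha>)) (k - 1) \<le> real n powr \<alpha> / Gamma (1 + \<alpha>)" .
    qed (use assms in auto)
    ultimately have "w k - w 0 \<le> B * (e k - 1) + (B - w 0)"
      by (simp add: B_def)
    then show ?case by (simp add: algebra_simps)
  qed
  have "w n \<le> B * e n" using main assms by simp
  also have "\<dots> \<le> B * mittag_leffler \<alpha> (\<kappa> * real n powr \<alpha>)"
    using B assms unfolding e_def by (intro mult_left_mono delay_majorant_le_mittag_leffler)
  finally show ?thesis by (simp add: B_def mult.commute)
qed

subsection \<open>Square-integrable functions\<close>

lemma in_L2_iff: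
  "in_L2 L v \<longleftrightarrow> (\<lambda>x. indicator {0<..<L} x * v x) \<in> borel_measurable lborel
     \<and> integrable lborel (\<lambda>x. (indicator {0<..<L} x * v x)\<^sup>2)"
proof -
  have "(\<lambda>x. (indicator {0<..<L} x * v x)\<^sup>2) = (\<lambda>x. indicator {0<..<L} x * (v x)\<^sup>2)"
    by (auto simp: indicator_def)
  then show ?thesis
    by (simp add: in_L2_def set_borel_measurable_def set_integrable_def)
qed

lemma inner_L2_eq:
  "inner_L2 L v w = (\<integral>x. (indicator {0<..<L} x * v x) * (indicator {0<..<L} x * w x) \<partial>lborel)"
  unfolding inner_L2_def set_lebesgue_integral_def
  by (intro Bochner_Integration.integral_cong) (auto simp: indicator_def)

text \<open>The product is dominated by the sum of the squares. Additivity of the inner product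
  rests on this, since the Bochner integral is additive only on integrable functions.\<close>

lemma in_L2_integrable_mult:
  assumes "in_L2 L v" "in_L2 L w"
  shows "integrable lborel (\<lambda>x. (indicator {0<..<L} x * v x) * (indicator {0<..<L} x * w x))"
proof -
  let ?v = "\<lambda>x. indicator {0<..<L} x * v x" and ?w = "\<lambda>x. indicator {0<..<L} x * w x"
  have "integrable lborel (\<lambda>x. (?v x)\<^sup>2 + (?w x)\<^sup>2)"
    using assms by (auto simp: in_L2_iff)
  then show ?thesis
  proof (rule Bochner_Integration.integrable_bound)
    show "AE x in lborel. norm (?v x * ?w x) \<le> norm ((?v x)\<^sup>2 + (?w x)\<^sup>2)"
    proof (rule AE_I2)
      fix x
      have "2 * (\<bar>?v x\<bar> * \<bar>?w x\<bar>) \<le> (?v x)\<^sup>2 + (?w x)\<^sup>2"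
        using zero_le_power2[of "\<bar>?v x\<bar> - \<bar>?w x\<bar>"] by (simp add: power2_diff)
      moreover have "0 \<le> \<bar>?v x\<bar> * \<bar>?w x\<bar>" by simp
      ultimately have "\<bar>?v x\<bar> * \<bar>?w x\<bar> \<le> (?v x)\<^sup>2 + (?w x)\<^sup>2" by linarith
      then show "norm (?v x * ?w x) \<le> norm ((?v x)\<^sup>2 + (?w x)\<^sup>2)"
        by (simp add: abs_mult)
    qed
  qed (use assms in \<open>auto simp: in_L2_iff\<close>)
qed

lemma in_L2_add:
  assumes "in_L2 L v" "in_L2 L w"
  shows "in_L2 L (\<lambda>x. v x + w x)"
proof -
  let ?v = "\<lambda>x. indicator {0<..<L} x * v x" and ?w = "\<lambda>x. indicator {0<..<L} x * w x"
  have "(\<lambda>x. ?v x + ?w x) \<in> borel_measurable lborel"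
    using assms by (auto simp: in_L2_iff)
  moreover have "integrable lborel (\<lambda>x. (?v x)\<^sup>2 + (?w x)\<^sup>2 + 2 * (?v x * ?w x))"
    using assms in_L2_integrable_mult[OF assms]
    by (intro Bochner_Integration.integrable_add integrable_mult_right) (auto simp: in_L2_iff)
  moreover have "(\<lambda>x. (?v x)\<^sup>2 + (?w x)\<^sup>2 + 2 * (?v x * ?w x)) = (\<lambda>x. (indicator {0<..<L} x * (v x + w x))\<^sup>2)"
    by (simp add: power2_sum distrib_left mult.assoc)
  ultimately show ?thesis
    by (simp add: in_L2_iff distrib_left)
qed

lemma in_L2_cmult:
  assumes "in_L2 L v"
  shows "in_L2 L (\<lambda>x. r * v x)"
proof -
  have "indicator {0<..<L} x * (r * v x) = r * (indicator {0<..<L} x * v x)" for x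
    by (rule mult.left_commute)
  moreover have "integrable lborel (\<lambda>x. r\<^sup>2 * (indicator {0<..<L} x * v x)\<^sup>2)"
    using assms by (simp add: in_L2_iff)
  moreover have "(\<lambda>x. r * (indicator {0<..<L} x * v x)) \<in> borel_measurable lborel"
    using assms by (auto simp: in_L2_iff)
  ultimately show ?thesis
    unfolding in_L2_iff by (simp only: power_mult_distrib[of r])
qed

lemma in_L2_zero: "in_L2 L (\<lambda>x. 0)"
  by (simp add: in_L2_iff)

lemma in_L2_sum:
  assumes "\<And>i. i \<in> I \<Longrightarrow> in_L2 L (v i)"
  shows "in_L2 L (\<lambda>x. \<Sum>i\<in>I. v i x)"
  using assms
  by (induction I rule: infinite_finite_induct) (auto intro: in_L2_zero in_L2_add)

lemma inner_L2_add:
  assumes "in_L2 L v" "in_L2 L w" "in_L2 L z"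
  shows "inner_L2 L (\<lambda>x. v x + w x) z = inner_L2 L v z + inner_L2 L w z"
  unfolding inner_L2_eq
  using Bochner_Integration.integral_add[OF in_L2_integrable_mult[OF assms(1,3)]
      in_L2_integrable_mult[OF assms(2,3)]]
  by (simp add: algebra_simps)

lemma inner_L2_cmult: "inner_L2 L (\<lambda>x. r * v x) z = r * inner_L2 L v z"
  unfolding inner_L2_def set_lebesgue_integral_def
  by (simp add: mult_ac flip: integral_mult_right_zero)

lemma inner_L2_commute: "inner_L2 L v w = inner_L2 L w v"
  unfolding inner_L2_def by (simp add: mult.commute)

lemma inner_L2_sum:
  assumes "\<And>i. i \<in> I \<Longrightarrow> in_L2 L (v i)" "in_L2 L z"
  shows "inner_L2 L (\<lambda>x. \<Sum>i\<in>I. v i x) z = (\<Sum>i\<in>I. inner_L2 L (v i) z)"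
  using assms(1)
proof (induction I rule: infinite_finite_induct)
  case (insert i I)
  then show ?case
    using assms(2) by (simp add: inner_L2_add in_L2_sum)
qed (simp_all add: inner_L2_def)

lemma inner_L2_self_nonneg: "0 \<le> inner_L2 L v v"
  unfolding inner_L2_eq by (intro Bochner_Integration.integral_nonneg) simp

lemma norm_L2_nonneg: "0 \<le> norm_L2 L v"
  by (simp add: norm_L2_def inner_L2_self_nonneg)

lemma norm_L2_power2: "(norm_L2 L v)\<^sup>2 = inner_L2 L v v"
  by (simp add: norm_L2_def inner_L2_self_nonneg)

lemma norm_L2_cmult: "norm_L2 L (\<lambda>x. r * v x) = \<bar>r\<bar> * norm_L2 L v"
proof -
  have "inner_L2 L (\<lambda>x. r * v x) (\<lambda>x. r * v x) = r\<^sup>2 * inner_L2 L v v"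
    by (subst inner_L2_cmult, subst inner_L2_commute, subst inner_L2_cmult)
       (simp add: power2_eq_square)
  then show ?thesis
    by (simp add: norm_L2_def real_sqrt_mult)
qed

text \<open>Cauchy-Schwarz, from the fact that the squared norm of \<open>v + r * w\<close> is a
  nonnegative quadratic polynomial in \<open>r\<close>.\<close>

lemma abs_inner_L2_le_norm:
  assumes "in_L2 L v" "in_L2 L w"
  shows "\<bar>inner_L2 L v w\<bar> \<le> norm_L2 L v * norm_L2 L w"
proof -
  have quad: "0 \<le> inner_L2 L v v + 2 * r * inner_L2 L v w + r\<^sup>2 * inner_L2 L w w" for r
  proof -
    have rw: "in_L2 L (\<lambda>x. r * w x)" by (intro in_L2_cmult assms)
    have vrw: "in_L2 L (\<lambda>x. v x + r * w x)" by (intro in_L2_add assms rw)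
    have 1: "inner_L2 L v (\<lambda>x. v x + r * w x) = inner_L2 L v v + r * inner_L2 L v w"
      using inner_L2_add[OF assms(1) rw assms(1)] 
      by (simp add: inner_L2_cmult inner_L2_commute[of L v "\<lambda>x. v x + r * w x"] inner_L2_commute[of L w v])
    have 2: "inner_L2 L w (\<lambda>x. v x + r * w x) = inner_L2 L v w + r * inner_L2 L w w"
      using inner_L2_add[OF assms(1) rw assms(2)] 
      by (simp add: inner_L2_cmult inner_L2_commute[of L w "\<lambda>x. v x + r * w x"])
    have "inner_L2 L (\<lambda>x. v x + r * w x) (\<lambda>x. v x + r * w x)
        = inner_L2 L v v + 2 * r * inner_L2 L v w + r\<^sup>2 * inner_L2 L w w"
      by (simp add: inner_L2_add[OF assms(1) rw vrw] inner_L2_cmult 1 2 algebra_simps power2_eq_square)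
    then show ?thesis using inner_L2_self_nonneg by metis
  qed
  have "(inner_L2 L v w)\<^sup>2 \<le> inner_L2 L v v * inner_L2 L w w"
  proof (cases "inner_L2 L w w = 0")
    case True
    have "inner_L2 L v w = 0"
    proof (rule ccontr)
      assume "inner_L2 L v w \<noteq> 0"
      \<comment> \<open>Here the polynomial is affine in \<open>r\<close>, and this \<open>r\<close>
        gives it the value -1.\<close>
      then show False
        using quad[of "- (inner_L2 L v v + 1) / (2 * inner_L2 L v w)"] True by (simp add: field_simps)
    qed
    then show ?thesis using True by simp
  next
    case False
    then have "inner_L2 L w w > 0" using inner_L2_self_nonneg[of L w] by linarith
    \<comment> \<open>This \<open>r\<close> is the minimiser of the quadratic.\<close>
    then show ?thesis
      using quad[of "- inner_L2 L v w / inner_L2 L w w"]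
      by (simp add: field_simps power2_eq_square)
  qed
  then show ?thesis
    unfolding norm_L2_def real_sqrt_mult[symmetric] by (intro real_le_rsqrt) simp
qed

section \<open>Square integrability of the data terms and of the finite element functions\<close>

lemma bounded_imp_in_L2:
  fixes v :: "real \<Rightarrow> real"
  assumes "\<And>x. x \<in> {0<..<L} \<Longrightarrow> \<bar>v x\<bar> \<le> C"
    and "(\<lambda>x. indicator {0<..<L} x * v x) \<in> borel_measurable borel"
  shows "in_L2 L v"
proof -
  have "integrable lborel (\<lambda>x. indicator {0<..<L} x * C\<^sup>2)"
    using emeasure_bounded_finite[of "{0<..<L}"] by (intro integrable_mult_left integrable_real_indicator) simp_all
  then have "integrable lborel (\<lambda>x. (indicator {0<..<L} x * v x)\<^sup>2)"
  proof (rule Bochner_Integration.integrable_bound)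
    show "AE x in lborel. norm ((indicator {0<..<L} x * v x)\<^sup>2) \<le> norm (indicator {0<..<L} x * C\<^sup>2)"
    proof (rule AE_I2)
      fix x
      show "norm ((indicator {0<..<L} x * v x)\<^sup>2) \<le> norm (indicator {0<..<L} x * C\<^sup>2)"
        using assms(1)[of x] power_mono[of "\<bar>v x\<bar>" C 2] by (auto simp: indicator_def)
    qed
  qed (use assms in simp)
  then show ?thesis using assms by (simp add: in_L2_iff)
qed

lemma continuous_on_imp_in_L2:
  assumes "continuous_on {0..L} v"
  shows "in_L2 L v"
proof -
  have "compact (v ` {0..L})" by (intro compact_continuous_image assms) simp
  then obtain C where C: "\<And>x. x \<in> {0..L} \<Longrightarrow> \<bar>v x\<bar> \<le> C"
    by (metis bounded_iff compact_imp_bounded imageI real_norm_def)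
  have "continuous_on {0<..<L} v" by (rule continuous_on_subset[OF assms]) auto
  then have "(\<lambda>x. indicator {0<..<L} x *\<^sub>R v x) \<in> borel_measurable borel"
    by (intro borel_measurable_continuous_on_indicator) auto
  with C show ?thesis by (intro bounded_imp_in_L2[of L v C]) auto
qed

text \<open>The reflection \<open>s \<mapsto> t - s\<close> moves the integrable singularity of
  \<open>s powr (- \<alpha>)\<close> from 0 to \<open>t\<close>.\<close>

lemma integrable_fractional_kernel:
  fixes \<alpha> t :: real
  assumes "\<alpha> < 1" "0 \<le> t"
  shows "integrable lborel (\<lambda>s. indicator {0..t} s * (t - s) powr (- \<alpha>))"
proof -
  have "(\<lambda>s. s powr (- \<alpha>)) absolutely_integrable_on {0..t}"
    using assms by (intro nonnegative_absolutely_integrable_1 integrable_on_powr_from_0) auto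
  then have "integrable lborel (\<lambda>s. indicator {0..t} s * s powr (- \<alpha>))"
    by (simp add: set_integrable_def integrable_completion)
  then have "integrable lborel (\<lambda>s. indicator {0..t} (t + - 1 * s) * (t + - 1 * s) powr (- \<alpha>))"
    by (rule lborel_integrable_real_affine) simp
  moreover have "indicator {0..t} (t + - 1 * s) = (indicator {0..t} s :: real)" for s
    by (auto simp: indicator_def)
  ultimately show ?thesis by simp
qed

text \<open>A bound for \<open>f\<close> times the integral of the kernel bounds
  \<open>f_tilde\<close> uniformly in \<open>x\<close>; its measurability is that of an integral
  depending on a parameter.\<close>

lemma f_tilde_in_L2:
  assumes "\<alpha> < 1" "0 \<le> t"
    and cont: "continuous_on ({0..L} \<times> {0..t}) (\<lambda>(y, s). f y s)"
  shows "in_L2 L (\<lambda>x. f_tilde \<alpha> f x t)"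
proof -
  define k where "k s = indicator {0..t} s * (t - s) powr (- \<alpha>)" for s
  \<comment> \<open>Extension of \<open>f\<close> by 0 gives an integrand that is jointly measurable
    on the plane.\<close>
  define G where "G = (\<lambda>z. indicator ({0..L} \<times> {0..t}) z *\<^sub>R (\<lambda>(y, s). f y s) z)"
  have "compact ((\<lambda>(y, s). f y s) ` ({0..L} \<times> {0..t}))"
    by (intro compact_continuous_image cont compact_Times) auto
  then obtain C where "\<forall>z \<in> (\<lambda>(y, s). f y s) ` ({0..L} \<times> {0..t}). norm z \<le> C"
    by (meson bounded_iff compact_imp_bounded)
  then have C: "\<bar>f x s\<bar> \<le> C" if "x \<in> {0..L}" "s \<in> {0..t}" for x s
    using that by force
  have "G \<in> borel_measurable borel"
    unfolding G_def by (intro borel_measurable_continuous_on_indicator cont) (auto intro!: borel_closed closed_Times)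
  then have G[measurable]: "G \<in> borel_measurable (borel \<Otimes>\<^sub>M borel)"
    by (simp add: borel_prod)
  have k[measurable]: "k \<in> borel_measurable borel"
    unfolding k_def by measurable
  have eq: "indicator {0<..<L} x * f_tilde \<alpha> f x t =
      indicator {0<..<L} x * (\<integral>s. k s / Gamma (1 - \<alpha>) * G (x, s) \<partial>lborel)" for x
    unfolding f_tilde_def set_lebesgue_integral_def k_def G_def
    by (cases "x \<in> {0<..<L}") (auto intro!: Bochner_Integration.integral_cong simp: indicator_def)
  have int: "integrable lborel (\<lambda>s. k s * (C / Gamma (1 - \<alpha>)))"
    unfolding k_def by (intro integrable_mult_left integrable_fractional_kernel assms)
  show ?thesis
  proof (rule bounded_imp_in_L2)
    fix x assume x: "x \<in> {0<..<L}"
    have bound: "norm (k s / Gamma (1 - \<alpha>) * G (x, s)) \<le> k s * (C / Gamma (1 - \<alpha>))" for s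
    proof (cases "s \<in> {0..t}")
      case True
      then have "\<bar>G (x, s)\<bar> \<le> C"
        using C[of x s] x by (simp add: G_def)
      then have "k s / Gamma (1 - \<alpha>) * \<bar>G (x, s)\<bar> \<le> k s / Gamma (1 - \<alpha>) * C"
        using assms by (intro mult_left_mono) (auto simp: k_def)
      then show ?thesis
        using assms by (simp add: abs_mult k_def)
    qed (simp add: k_def)
    have "integrable lborel (\<lambda>s. k s / Gamma (1 - \<alpha>) * G (x, s))"
      using int
    proof (rule Bochner_Integration.integrable_bound)
      show "AE s in lborel. norm (k s / Gamma (1 - \<alpha>) * G (x, s)) \<le> norm (k s * (C / Gamma (1 - \<alpha>)))"
        using bound by (intro AE_I2) (metis abs_ge_self order_trans real_norm_def)
    qed measurable
    then have "norm (\<integral>s. k s / Gamma (1 - \<alpha>) * G (x, s) \<partial>lborel) \<le> (\<integral>s. k s * (C / Gamma (1 - \<alpha>)) \<partial>lborel)"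
      by (rule Bochner_Integration.integral_norm_bound_integral[OF _ int bound])
    then have "norm (f_tilde \<alpha> f x t) \<le> (\<integral>s. k s * (C / Gamma (1 - \<alpha>)) \<partial>lborel)"
      using eq[of x] x by simp
    then show "\<bar>f_tilde \<alpha> f x t\<bar> \<le> (\<integral>s. k s * (C / Gamma (1 - \<alpha>)) \<partial>lborel)" by simp
  next
    have "(\<lambda>x. indicator {0<..<L} x * (\<integral>s. k s / Gamma (1 - \<alpha>) * G (x, s) \<partial>lborel)) \<in> borel_measurable borel"
      by measurable
    then show "(\<lambda>x. indicator {0<..<L} x * f_tilde \<alpha> f x t) \<in> borel_measurable borel"
      by (simp add: eq)
  qed
qed

lemma H_term_in_L2:
  assumes "in_L2 L \<phi>'" "in_L2 L (\<lambda>x. \<phi> x (- \<tau>))"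
  shows "in_L2 L (H_term \<alpha> \<rho> N \<tau> \<phi> \<phi>' n)"
proof -
  have "in_L2 L (\<lambda>x. r * \<phi>' x + s * \<phi> x (- \<tau>))" for r s
    by (intro in_L2_add in_L2_cmult assms)
  from this[of "\<rho> powr (1 - \<alpha>) * (\<Sum>k = N..n. g_coeff (\<alpha> - 1) (nat (n - k)) * (of_int k * \<rho> - \<tau>))"
      "- (\<rho> powr (1 - \<alpha>) * (\<Sum>k = 0..n. g_coeff (\<alpha> - 1) (nat (n - k))))"]
  show ?thesis
    unfolding H_term_def by (simp add: mult_ac)
qed

text \<open>Both branches are \<open>f_tilde\<close> plus a scalar combination of
  \<open>\<phi>'\<close> and \<open>\<phi>\<close> at \<open>- \<tau>\<close>; in the first the
  coefficient of \<open>\<phi>'\<close> is 0.\<close>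

lemma F_term_in_L2:
  assumes "\<alpha> < 1" "0 \<le> of_int n * \<rho>"
    and "continuous_on ({0..L} \<times> {0..of_int n * \<rho>}) (\<lambda>(y, s). f y s)"
    and "in_L2 L \<phi>'" "in_L2 L (\<lambda>x. \<phi> x (- \<tau>))"
  shows "in_L2 L (F_term \<alpha> \<rho> \<tau> b f \<phi> \<phi>' n)"
proof -
  have *: "in_L2 L (\<lambda>x. f_tilde \<alpha> f x (of_int n * \<rho>) + (r * \<phi>' x + s * \<phi> x (- \<tau>)))" for r s
    by (intro in_L2_add in_L2_cmult f_tilde_in_L2 assms)
  let ?t = "of_int n * \<rho>"
  show ?thesis
  proof (cases "?t \<le> \<tau>")
    case True
    then show ?thesis
      using *[of 0 "b * (?t powr (1 - \<alpha>) / Gamma (2 - \<alpha>))"] by (simp add: F_term_def[abs_def] Let_def)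
  next
    case False
    then show ?thesis
      using *[of "- b * ((?t - \<tau>) powr (2 - \<alpha>) / Gamma (3 - \<alpha>))" "b * (?t powr (1 - \<alpha>) / Gamma (2 - \<alpha>))"]
      by (simp add: F_term_def[abs_def] Let_def algebra_simps)
  qed
qed

lemma fe_space_in_L2: "v \<in> fe_space L M x \<Longrightarrow> in_L2 L v"
  by (auto simp: fe_space_def intro: continuous_on_imp_in_L2)

subsection \<open>The stability estimate\<close>

text \<open>Summation by parts. The conditions record that \<open>v 0\<close> is never the upper and
  \<open>v (Suc k)\<close> never the lower end of an increment.\<close>

lemma sum_antidiagonal_diff:
  fixes a v :: "nat \<Rightarrow> real"
  shows "(\<Sum>i\<le>k. a (k - i) * (v (Suc i) - v i)) =
    (\<Sum>i\<le>Suc k. ((if i = 0 then 0 else a (Suc k - i)) - (if i = Suc k then 0 else a (k - i))) * v i)"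
proof -
  have "(\<Sum>i\<le>Suc k. (if i = 0 then 0 else a (Suc k - i)) * v i) = (\<Sum>i\<le>k. a (k - i) * v (Suc i))"
    by (subst sum.atMost_Suc_shift) simp
  moreover have "(\<Sum>i\<le>Suc k. (if i = Suc k then 0 else a (k - i)) * v i) = (\<Sum>i\<le>k. a (k - i) * v i)"
    by (simp add: sum.atMost_Suc)
  ultimately show ?thesis
    by (simp only: left_diff_distrib right_diff_distrib sum_subtractf)
qed

lemma A_coeff_nonneg:
  assumes "0 < \<alpha>" "\<alpha> < 1" "0 < \<rho>"
  shows "0 \<le> A_coeff \<alpha> \<rho> k"
  using assms by (auto simp: A_coeff_def intro!: mult_nonneg_nonneg divide_nonneg_nonneg Gamma_real_nonneg)

lemma A_coeff_eq_g_coeff: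
  assumes "0 < \<alpha>" "\<alpha> < 1" "0 < \<rho>"
  shows "A_coeff \<alpha> \<rho> (int k) = \<rho> powr (- \<alpha>) * g_coeff (\<alpha> - 1) k"
proof -
  have "\<rho> * A_coeff \<alpha> \<rho> (int k) = \<rho> * (\<rho> powr (- \<alpha>) * g_coeff (\<alpha> - 1) k)"
    using assms g_coeff_eq_A_coeff[OF assms, of k] by (simp add: powr_diff powr_minus divide_inverse)
  then show ?thesis using assms by simp
qed

text \<open>Passes from integer time levels to natural indices, on which the generating function
  identities act; time level \<open>Suc k\<close> becomes coefficient index
  \<open>k\<close>.\<close>

lemma frac_diff_eq_g_coeff:
  assumes "0 < \<alpha>" "\<alpha> < 1" "0 < \<rho>"
  shows "frac_diff \<alpha> \<rho> v (int (Suc k)) =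
    \<rho> powr (- \<alpha>) * (\<Sum>i\<le>k. g_coeff (\<alpha> - 1) (k - i) * (v (int (Suc i)) - v (int i)))"
proof -
  have "frac_diff \<alpha> \<rho> v (int (Suc k)) =
      (\<Sum>i\<le>k. A_coeff \<alpha> \<rho> (int (k - i)) * (v (int (Suc i)) - v (int i)))"
    unfolding frac_diff_def
    by (rule sum.reindex_bij_witness[of _ "\<lambda>i. int (Suc i)" "\<lambda>j. nat (j - 1)"])
       (auto simp: of_nat_diff algebra_simps)
  then show ?thesis
    by (simp only: A_coeff_eq_g_coeff[OF assms] sum_distrib_left mult.assoc)
qed

text \<open>After summation by parts, pairing with the newest value gives a combination of inner
  products; each is compared with a product of norms, and the common norm is divided out.\<close>

lemma frac_diff_norm_L2_le:
  assumes "0 < \<alpha>" "\<alpha> < 1" "0 < \<rho>" "0 \<le> R"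
    and v: "\<And>i. i \<le> Suc k \<Longrightarrow> in_L2 L (v (int i))"
    and le: "inner_L2 L (\<lambda>x. frac_diff \<alpha> \<rho> (\<lambda>i. v i x) (int (Suc k))) (v (int (Suc k)))
      \<le> R * norm_L2 L (v (int (Suc k)))"
  shows "frac_diff \<alpha> \<rho> (\<lambda>i. norm_L2 L (v i)) (int (Suc k)) \<le> R"
proof -
  let ?g = "g_coeff (\<alpha> - 1)" and ?n = "int (Suc k)"
  define q where "q i = \<rho> powr (- \<alpha>) *
    ((if i = 0 then 0 else ?g (Suc k - i)) - (if i = Suc k then 0 else ?g (k - i)))" for i
  have fd: "frac_diff \<alpha> \<rho> z ?n = (\<Sum>i\<le>Suc k. q i * z (int i))" for z
    unfolding frac_diff_eq_g_coeff[OF assms(1-3)]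
    using sum_antidiagonal_diff[of ?g k "\<lambda>i. z (int i)"]
    by (simp only: q_def sum_distrib_left mult.assoc)
  have g_nonneg: "?g i \<ge> 0" and g_decr: "?g (Suc i) \<le> ?g i" for i
    using g_coeff_uminus_nonneg[of "1 - \<alpha>" i] g_coeff_uminus_antimono[of "1 - \<alpha>" i] assms by simp_all
  \<comment> \<open>Only the diagonal weight is positive, so Cauchy-Schwarz acts in the right direction.\<close>
  have q_nonpos: "q i \<le> 0" if "i \<le> k" for i
    using that g_nonneg[of k] g_decr[of "k - i"] assms unfolding q_def
    by (intro mult_nonneg_nonpos) (auto simp: Suc_diff_le)
  have "(\<Sum>i\<le>Suc k. q i * norm_L2 L (v (int i))) * norm_L2 L (v ?n)
      = (\<Sum>i\<le>Suc k. q i * (norm_L2 L (v (int i)) * norm_L2 L (v ?n)))"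
    by (simp only: sum_distrib_right mult.assoc)
  also have "\<dots> \<le> (\<Sum>i\<le>Suc k. q i * inner_L2 L (v (int i)) (v ?n))"
  proof (intro sum_mono)
    fix i assume i: "i \<in> {..Suc k}"
    show "q i * (norm_L2 L (v (int i)) * norm_L2 L (v ?n)) \<le> q i * inner_L2 L (v (int i)) (v ?n)"
    proof (cases "i = Suc k")
      case True
      then show ?thesis
        by (simp only: norm_L2_power2 flip: power2_eq_square)
    next
      case False
      have "inner_L2 L (v (int i)) (v ?n) \<le> norm_L2 L (v (int i)) * norm_L2 L (v ?n)"
        using abs_inner_L2_le_norm[of L "v (int i)" "v ?n"] i v by fastforce
      then show ?thesis
        using q_nonpos[of i] i False by (intro mult_left_mono_neg) auto
    qed
  qed
  also have "\<dots> = inner_L2 L (\<lambda>x. frac_diff \<alpha> \<rho> (\<lambda>i. v i x) ?n) (v ?n)"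
    unfolding fd
    by (subst inner_L2_sum) (auto intro!: in_L2_cmult v simp: inner_L2_cmult simp del: of_nat_Suc sum.atMost_Suc)
  also have "\<dots> \<le> R * norm_L2 L (v ?n)" by (rule le)
  finally have mult: "frac_diff \<alpha> \<rho> (\<lambda>i. norm_L2 L (v i)) ?n * norm_L2 L (v ?n) \<le> R * norm_L2 L (v ?n)"
    by (simp only: fd)
  show ?thesis
  proof (cases "norm_L2 L (v ?n) = 0")
    case True
    \<comment> \<open>Division is impossible here, but the diagonal term is 0 and the remaining
      weights are nonpositive.\<close>
    have "(\<Sum>i\<le>k. q i * norm_L2 L (v (int i))) \<le> 0"
      using q_nonpos norm_L2_nonneg by (intro sum_nonpos mult_nonpos_nonneg) auto
    then have "frac_diff \<alpha> \<rho> (\<lambda>i. norm_L2 L (v i)) ?n \<le> 0"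
      unfolding fd using True by (simp del: of_nat_Suc)
    then show ?thesis using assms by simp
  next
    case False
    then have "norm_L2 L (v ?n) > 0" using norm_L2_nonneg[of L "v ?n"] by linarith
    then show ?thesis using mult mult_le_cancel_right_pos by blast
  qed
qed

lemma sum_quadrature_weights_le:
  assumes "0 < \<alpha>" "\<alpha> < 1" "0 < \<rho>" "0 \<le> n"
  shows "\<rho> powr (1 - \<alpha>) * (\<Sum>k = 0..n. g_coeff (\<alpha> - 1) (nat (n - k)))
    \<le> \<rho> powr (1 - \<alpha>) + (of_int n * \<rho>) powr (1 - \<alpha>) / Gamma (2 - \<alpha>)"
proof -
  have "(\<Sum>k = 0..n. g_coeff (\<alpha> - 1) (nat (n - k))) = (\<Sum>i\<le>nat n. g_coeff (\<alpha> - 1) i)"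
    using assms by (intro sum.reindex_bij_witness[of _ "\<lambda>i. n - int i" "\<lambda>k. nat (n - k)"]) auto
  also have "\<dots> \<le> 1 + real (nat n) powr (1 - \<alpha>) / Gamma (2 - \<alpha>)"
    by (intro sum_g_coeff_le assms)
  finally have "\<rho> powr (1 - \<alpha>) * (\<Sum>k = 0..n. g_coeff (\<alpha> - 1) (nat (n - k)))
      \<le> \<rho> powr (1 - \<alpha>) * (1 + real (nat n) powr (1 - \<alpha>) / Gamma (2 - \<alpha>))"
    by (intro mult_left_mono) auto
  then show ?thesis
    using assms by (simp add: powr_mult algebra_simps)
qed

text \<open>Multiplication by \<open>\<rho> powr \<alpha>\<close> frees the difference of the step
  size; the same factor moves into both constants, where it combines with
  \<open>n powr \<alpha>\<close> to a power of the time \<open>n * \<rho>\<close>.\<close>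

lemma frac_diff_gronwall:
  fixes w :: "int \<Rightarrow> real"
  assumes "0 < \<alpha>" "\<alpha> < 1" "0 < \<rho>" "0 \<le> \<Lambda>" "0 \<le> Y" "0 \<le> w 0" "1 \<le> n"
    and ineq: "\<And>k m. k \<in> {1..n} \<Longrightarrow> 0 \<le> m \<Longrightarrow> (\<And>i. 1 \<le> i \<Longrightarrow> i < k \<Longrightarrow> w i \<le> m) \<Longrightarrow>
      frac_diff \<alpha> \<rho> w k \<le> \<Lambda> * m + Y"
  shows "w n \<le> mittag_leffler \<alpha> (\<Lambda> * (of_int n * \<rho>) powr \<alpha>)
    * (w 0 + (of_int n * \<rho>) powr \<alpha> / Gamma (1 + \<alpha>) * Y)"
proof -
  let ?w = "\<lambda>i. w (int i)"
  have "?w (nat n) \<le> mittag_leffler \<alpha> (\<Lambda> * \<rho> powr \<alpha> * real (nat n) powr \<alpha>)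
      * (?w 0 + real (nat n) powr \<alpha> / Gamma (1 + \<alpha>) * (\<rho> powr \<alpha> * Y))"
  proof (rule discrete_fractional_gronwall)
    fix k m
    assume k: "k < nat n" and m: "0 \<le> m" and le: "\<And>i. 1 \<le> i \<Longrightarrow> i \<le> k \<Longrightarrow> ?w i \<le> m"
    let ?S = "\<Sum>i\<le>k. g_coeff (\<alpha> - 1) (k - i) * (?w (Suc i) - ?w i)"
    have "frac_diff \<alpha> \<rho> w (int (Suc k)) \<le> \<Lambda> * m + Y"
    proof (rule ineq)
      show "w i \<le> m" if "1 \<le> i" "i < int (Suc k)" for i
        using le[of "nat i"] that by simp
    qed (use k m in auto)
    then have "\<rho> powr \<alpha> * (\<rho> powr (- \<alpha>) * ?S) \<le> \<rho> powr \<alpha> * (\<Lambda> * m + Y)"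
      unfolding frac_diff_eq_g_coeff[OF assms(1-3)] by (intro mult_left_mono) auto
    moreover have "\<rho> powr \<alpha> * (\<rho> powr (- \<alpha>) * ?S) = ?S"
      using assms(3) by (simp add: powr_minus flip: mult.assoc)
    ultimately have "?S \<le> \<rho> powr \<alpha> * (\<Lambda> * m + Y)"
      by (simp only:)
    then show "?S \<le> \<Lambda> * \<rho> powr \<alpha> * m + \<rho> powr \<alpha> * Y"
      by (simp add: distrib_left mult_ac)
  qed (use assms in auto)
  then show ?thesis
    using assms by (simp add: powr_mult mult_ac)
qed

text \<open>Energy estimate with test function \<open>u n\<close>: the signs of \<open>p\<close> and
  \<open>a\<close> discard two terms, and Cauchy-Schwarz gives all others the factor
  \<open>norm_L2 L (u n)\<close>.\<close>

lemma fe_scheme_frac_diff_norm_le: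
  assumes "0 < \<alpha>" "\<alpha> < 1" "0 \<le> p" "a \<le> 0" "0 < \<tau>" "1 \<le> N" "n \<in> {1..K * N}"
    and scheme: "fe_scheme \<alpha> L p a b \<tau> N K f \<phi> \<phi>' X u"
    and X: "\<And>v. v \<in> X \<Longrightarrow> in_L2 L v"
    and \<rho>: "\<rho> = \<tau> / of_int N"
    and H: "in_L2 L (H_term \<alpha> \<rho> N \<tau> \<phi> \<phi>' n)"
    and F: "in_L2 L (F_term \<alpha> \<rho> \<tau> b f \<phi> \<phi>' n)"
  shows "frac_diff \<alpha> \<rho> (\<lambda>k. norm_L2 L (u k)) n \<le>
    \<bar>b\<bar> * (\<rho> powr (1 - \<alpha>) * (\<Sum>k = 0..n. g_coeff (\<alpha> - 1) (nat (n - k)) * norm_L2 L (u (k - N))))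
    + \<bar>b\<bar> * norm_L2 L (H_term \<alpha> \<rho> N \<tau> \<phi> \<phi>' n) + norm_L2 L (F_term \<alpha> \<rho> \<tau> b f \<phi> \<phi>' n)"
    (is "_ \<le> ?R")
proof -
  let ?H = "H_term \<alpha> \<rho> N \<tau> \<phi> \<phi>' n" and ?F = "F_term \<alpha> \<rho> \<tau> b f \<phi> \<phi>' n"
  let ?J = "\<lambda>x. frac_int \<alpha> \<rho> N (\<lambda>k. u k x) (n - N)"
  have \<rho>_pos: "0 < \<rho>" using assms by simp
  have uX: "u i \<in> X" if "i \<in> {-N..K * N}" for i
    using scheme that unfolding fe_scheme_def Let_def by blast
  have uL2: "in_L2 L (u i)" if "- N \<le> i" "i \<le> n" for i
    using uX[of i] X that assms by auto
  have eq: "inner_L2 L (\<lambda>x. frac_diff \<alpha> \<rho> (\<lambda>k. u k x) n) (u n) =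
      - p * inner_L2 L (deriv (u n)) (deriv (u n)) + a * inner_L2 L (u n) (u n)
      + b * inner_L2 L ?J (u n) + b * inner_L2 L ?H (u n) + inner_L2 L ?F (u n)"
    using scheme uX[of n] assms unfolding fe_scheme_def Let_def \<rho> by auto
  have g_nonneg: "g_coeff (\<alpha> - 1) i \<ge> 0" for i
    using g_coeff_uminus_nonneg[of "1 - \<alpha>" i] assms by simp
  have J: "\<bar>inner_L2 L ?J (u n)\<bar> \<le>
      \<rho> powr (1 - \<alpha>) * (\<Sum>k = 0..n. g_coeff (\<alpha> - 1) (nat (n - k)) * norm_L2 L (u (k - N))) * norm_L2 L (u n)"
  proof -
    have "inner_L2 L ?J (u n) = \<rho> powr (1 - \<alpha>) *
        (\<Sum>k = 0..n. g_coeff (\<alpha> - 1) (nat (n - k)) * inner_L2 L (u (k - N)) (u n))"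
      unfolding frac_int_def inner_L2_cmult
      using assms by (subst inner_L2_sum) (auto intro!: in_L2_cmult uL2 simp: inner_L2_cmult)
    then have "\<bar>inner_L2 L ?J (u n)\<bar> \<le> \<rho> powr (1 - \<alpha>) *
        (\<Sum>k = 0..n. \<bar>g_coeff (\<alpha> - 1) (nat (n - k)) * inner_L2 L (u (k - N)) (u n)\<bar>)"
      by (auto simp: abs_mult intro!: mult_left_mono sum_abs[THEN order_trans])
    also have "\<dots> \<le> \<rho> powr (1 - \<alpha>) *
        (\<Sum>k = 0..n. g_coeff (\<alpha> - 1) (nat (n - k)) * (norm_L2 L (u (k - N)) * norm_L2 L (u n)))"
      using assms g_nonneg unfolding abs_mult
      by (intro mult_left_mono sum_mono) (auto intro!: mult_mono abs_inner_L2_le_norm uL2)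
    finally show ?thesis
      by (simp only: sum_distrib_right mult.assoc)
  qed
  have "inner_L2 L (\<lambda>x. frac_diff \<alpha> \<rho> (\<lambda>k. u k x) n) (u n)
      \<le> b * inner_L2 L ?J (u n) + b * inner_L2 L ?H (u n) + inner_L2 L ?F (u n)"
  proof -
    have "0 \<le> p * inner_L2 L (deriv (u n)) (deriv (u n))"
      using assms inner_L2_self_nonneg by (intro mult_nonneg_nonneg) auto
    moreover have "a * inner_L2 L (u n) (u n) \<le> 0"
      using assms inner_L2_self_nonneg by (intro mult_nonpos_nonneg) auto
    ultimately show ?thesis unfolding eq by simp
  qed
  also have "\<dots> \<le> \<bar>b\<bar> * \<bar>inner_L2 L ?J (u n)\<bar> + \<bar>b\<bar> * \<bar>inner_L2 L ?H (u n)\<bar> + \<bar>inner_L2 L ?F (u n)\<bar>"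
    by (intro add_mono) (simp_all flip: abs_mult)
  also have "\<dots> \<le> \<bar>b\<bar> * (\<rho> powr (1 - \<alpha>) * (\<Sum>k = 0..n. g_coeff (\<alpha> - 1) (nat (n - k)) * norm_L2 L (u (k - N))) * norm_L2 L (u n))
      + \<bar>b\<bar> * (norm_L2 L ?H * norm_L2 L (u n)) + norm_L2 L ?F * norm_L2 L (u n)"
    using assms by (intro add_mono mult_left_mono J abs_inner_L2_le_norm H F uL2) auto
  also have "\<dots> = ?R * norm_L2 L (u n)"
    by (simp add: algebra_simps)
  finally have le: "inner_L2 L (\<lambda>x. frac_diff \<alpha> \<rho> (\<lambda>k. u k x) n) (u n) \<le> ?R * norm_L2 L (u n)" .
  obtain k where k: "n = int (Suc k)"
    using assms(7) by (metis atLeastAtMost_iff int_one_le_iff_zero_less zero_less_imp_eq_int gr0_implies_Suc)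
  \<comment> \<open>This sign settles the case in which \<open>u n\<close> has norm 0.\<close>
  have "0 \<le> ?R"
    using g_nonneg norm_L2_nonneg
    by (intro add_nonneg_nonneg mult_nonneg_nonneg sum_nonneg) auto
  then show ?thesis
    using le uL2 assms unfolding k
    by (intro frac_diff_norm_L2_le[OF assms(1,2) \<rho>_pos]) auto
qed

text \<open>The sum from \<open>N\<close> to \<open>n\<close> is empty or consists of the term
  \<open>k = N\<close>, whose factor \<open>N * \<rho> - \<tau>\<close> is 0.\<close>

lemma H_term_le_delay:
  assumes "n \<le> N" "\<tau> = of_int N * \<rho>"
  shows "H_term \<alpha> \<rho> N \<tau> \<phi> \<phi>' n = (\<lambda>x.
    - (\<rho> powr (1 - \<alpha>) * (\<Sum>k = 0..n. g_coeff (\<alpha> - 1) (nat (n - k)))) * \<phi> x (- \<tau>))"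
proof -
  have "(\<Sum>k = N..n. g_coeff (\<alpha> - 1) (nat (n - k)) * (of_int k * \<rho> - \<tau>)) = 0"
    using assms by (intro sum.neutral) auto
  then show ?thesis
    by (simp add: H_term_def[abs_def] mult_ac)
qed

theorem theorem3p1:
  fixes \<alpha> L p a b \<tau> \<sigma> h \<rho> c :: real
    and N K :: int and M :: nat
    and x :: "nat \<Rightarrow> real"
    and f \<phi> :: "real \<Rightarrow> real \<Rightarrow> real" and \<phi>' :: "real \<Rightarrow> real"
    and u :: "int \<Rightarrow> real \<Rightarrow> real"
    and t :: "int \<Rightarrow> real"
    and H F :: "int \<Rightarrow> real \<Rightarrow> real"
  assumes "0 < \<alpha>" and "\<alpha> < 1" and "0 < L" and "0 \<le> p" and "a \<le> 0" and "b \<noteq> 0"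
    and "0 < \<tau>" and "1 \<le> K" and "1 \<le> N"
    and f_cont: "continuous_on ({0..L} \<times> {0..of_int K * \<tau>}) (\<lambda>(y, s). f y s)"
    and phi_cont: "continuous_on ({0..L} \<times> {-\<tau>..0}) (\<lambda>(y, s). \<phi> y s)"
    and phi_deriv: "\<And>y. y \<in> {0<..<L} \<Longrightarrow> (\<phi> y has_real_derivative \<phi>' y) (at 0 within {-\<tau>..0})"
    and phi_deriv_L2: "in_L2 L \<phi>'"
    and partition: "quasi_uniform_partition L \<sigma> h M x"
    and scheme: "fe_scheme \<alpha> L p a b \<tau> N K f \<phi> \<phi>' (fe_space L M x) u"
  defines "\<rho> \<equiv> \<tau> / of_int N"
    and "t \<equiv> \<lambda>n. of_int n * \<rho>"
    and "H \<equiv> H_term \<alpha> \<rho> N \<tau> \<phi> \<phi>'"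
    and "F \<equiv> F_term \<alpha> \<rho> \<tau> b f \<phi> \<phi>'"
    and "c \<equiv> (SUP k\<in>{0..N}. norm_L2 L (u (k - N)))"
  shows "\<forall>n\<in>{1..K * N}.
    let \<Lambda> = (if n \<le> N then 0
             else \<bar>b\<bar> * (\<rho> powr (1 - \<alpha>) + (of_int K * \<tau>) powr (1 - \<alpha>) / Gamma (2 - \<alpha>)));
        y = (\<lambda>k. if n \<le> N
                 then \<bar>b\<bar> * (\<rho> powr (1 - \<alpha>) + t k powr (1 - \<alpha>) / Gamma (2 - \<alpha>))
                          * (c + norm_L2 L (\<lambda>z. \<phi> z (-\<tau>)))
                      + norm_L2 L (F k)
                 else c * \<bar>b\<bar> * \<rho> * (\<Sum>j = 0..N. A_coeff \<alpha> \<rho> (k - j))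
                      + \<bar>b\<bar> * norm_L2 L (H k) + norm_L2 L (F k))
    in norm_L2 L (u n) \<le> 2 * mittag_leffler \<alpha> (2 powr (\<alpha> + 1) * \<Lambda> * t n powr \<alpha>)
         * (norm_L2 L (u 0) + 2 powr \<alpha> * t n powr \<alpha> / Gamma (1 + \<alpha>) * Max (y ` {1..n}))"
proof -

  \<comment> \<open>Regularity of the data and total quadrature weights\<close>
  have \<rho>: "0 < \<rho>" "\<tau> = of_int N * \<rho>"
    using assms(7,9) by (simp_all add: \<rho>_def)
  have t_le: "t k \<le> of_int K * \<tau>" if "k \<le> K * N" for k
  proof -
    have "t k \<le> of_int (K * N) * \<rho>"
      unfolding t_def using that \<rho>(1) by (intro mult_right_mono) (auto simp del: of_int_mult)
    then show ?thesis by (simp add: \<rho>(2) mult.assoc)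
  qed
  have t_nonneg: "0 \<le> t k" if "0 \<le> k" for k
    using that \<rho>(1) by (simp add: t_def)
  have "continuous_on {0..L} ((\<lambda>(y, s). \<phi> y s) \<circ> (\<lambda>y. (y, - \<tau>)))"
    by (intro continuous_on_compose continuous_intros continuous_on_subset[OF phi_cont])
       (use assms(7) in auto)
  then have phi_L2: "in_L2 L (\<lambda>z. \<phi> z (- \<tau>))"
    by (intro continuous_on_imp_in_L2) (simp add: o_def)
  have H_L2: "in_L2 L (H k)" for k
    unfolding H_def by (intro H_term_in_L2 phi_deriv_L2 phi_L2)
  have F_L2: "in_L2 L (F k)" if "1 \<le> k" "k \<le> K * N" for k
    unfolding F_def using that t_le[of k] t_nonneg[of k] assms(2)
    by (intro F_term_in_L2 phi_deriv_L2 phi_L2 continuous_on_subset[OF f_cont]) (auto simp: t_def)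
  have c: "norm_L2 L (u (k - N)) \<le> c" if "0 \<le> k" "k \<le> N" for k
    unfolding c_def using that by (intro cSUP_upper) auto
  have c_nonneg: "0 \<le> c"
    using c[of 0] norm_L2_nonneg[of L "u (0 - N)"] assms(9) by simp
  have g_nonneg: "g_coeff (\<alpha> - 1) i \<ge> 0" for i
    using g_coeff_uminus_nonneg[of "1 - \<alpha>" i] assms(2) by simp
  have A_nonneg: "A_coeff \<alpha> \<rho> k \<ge> 0" for k
    using A_coeff_nonneg assms(1,2) \<rho>(1) .
  have gA: "\<rho> powr (1 - \<alpha>) * g_coeff (\<alpha> - 1) (nat (k - j)) = \<rho> * A_coeff \<alpha> \<rho> (k - j)" if "j \<le> k" for j k
    using that g_coeff_eq_A_coeff[OF assms(1,2) \<rho>(1), of "nat (k - j)"] by simp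
  \<comment> \<open>\<open>S k\<close> is the total weight of the quadrature at level
    \<open>k\<close>, and \<open>W (t k)\<close> the bound for it that enters \<open>y\<close> and,
    at the final time, \<open>\<Lambda>\<close>.\<close>
  define S where "S k = \<rho> powr (1 - \<alpha>) * (\<Sum>j = 0..k. g_coeff (\<alpha> - 1) (nat (k - j)))" for k
  define W where "W s = \<rho> powr (1 - \<alpha>) + s powr (1 - \<alpha>) / Gamma (2 - \<alpha>)" for s
  have W_nonneg: "0 \<le> W s" for s
    using assms(2) by (simp add: W_def)
  have S_nonneg: "0 \<le> S k" for k
    unfolding S_def using g_nonneg by (intro mult_nonneg_nonneg sum_nonneg) auto
  have S_le: "S k \<le> W (t k)" if "0 \<le> k" for k
    unfolding S_def W_def t_def using that assms(1,2) \<rho>(1) by (intro sum_quadrature_weights_le)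
  have energy: "frac_diff \<alpha> \<rho> (\<lambda>k. norm_L2 L (u k)) k \<le>
      \<bar>b\<bar> * (\<rho> powr (1 - \<alpha>) * (\<Sum>j = 0..k. g_coeff (\<alpha> - 1) (nat (k - j)) * norm_L2 L (u (j - N))))
      + \<bar>b\<bar> * norm_L2 L (H k) + norm_L2 L (F k)" if "1 \<le> k" "k \<le> K * N" for k
    unfolding H_def F_def
    by (rule fe_scheme_frac_diff_norm_le[OF assms(1,2,4,5,7,9) _ scheme])
       (use that fe_space_in_L2 H_L2 F_L2 in \<open>auto simp: \<rho>_def H_def F_def\<close>)
  show ?thesis
  proof (rule ballI, unfold Let_def)

    \<comment> \<open>The scalar inequality for a fixed final level\<close>
    fix n assume n: "n \<in> {1..K * N}"
    define \<Lambda> where "\<Lambda> = (if n \<le> N then 0 else \<bar>b\<bar> * W (of_int K * \<tau>))"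
    define y where "y = (\<lambda>k. if n \<le> N
      then \<bar>b\<bar> * W (t k) * (c + norm_L2 L (\<lambda>z. \<phi> z (-\<tau>))) + norm_L2 L (F k)
      else c * \<bar>b\<bar> * \<rho> * (\<Sum>j = 0..N. A_coeff \<alpha> \<rho> (k - j))
        + \<bar>b\<bar> * norm_L2 L (H k) + norm_L2 L (F k))"
    define Y where "Y = Max (y ` {1..n})"
    have \<Lambda>_nonneg: "0 \<le> \<Lambda>" using W_nonneg by (simp add: \<Lambda>_def)
    have y_nonneg: "0 \<le> y k" for k
      unfolding y_def using c_nonneg W_nonneg norm_L2_nonneg A_nonneg \<rho>(1)
      by (auto intro!: add_nonneg_nonneg mult_nonneg_nonneg sum_nonneg)
    have y_le: "y k \<le> Y" if "k \<in> {1..n}" for k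
      unfolding Y_def using that by (intro Max_ge) auto
    have Y_nonneg: "0 \<le> Y" using y_le[of 1] y_nonneg[of 1] n by simp
    have ineq: "frac_diff \<alpha> \<rho> (\<lambda>k. norm_L2 L (u k)) k \<le> \<Lambda> * m + Y"
      if k: "k \<in> {1..n}" and m: "0 \<le> m" "\<And>i. 1 \<le> i \<Longrightarrow> i < k \<Longrightarrow> norm_L2 L (u i) \<le> m" for k m
    proof -
      let ?J = "\<rho> powr (1 - \<alpha>) * (\<Sum>j = 0..k. g_coeff (\<alpha> - 1) (nat (k - j)) * norm_L2 L (u (j - N)))"
      have "\<bar>b\<bar> * ?J + \<bar>b\<bar> * norm_L2 L (H k) + norm_L2 L (F k) \<le> \<Lambda> * m + y k"
      proof (cases "n \<le> N")
        case True
        \<comment> \<open>All delayed levels \<open>j - N\<close> are at most 0, so only starting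
          values enter; hence \<open>\<Lambda> = 0\<close> is possible.\<close>
        have "?J \<le> \<rho> powr (1 - \<alpha>) * (\<Sum>j = 0..k. g_coeff (\<alpha> - 1) (nat (k - j)) * c)"
          using k True g_nonneg by (intro mult_left_mono sum_mono c) auto
        also have "\<dots> = S k * c" by (simp add: S_def sum_distrib_right mult.assoc)
        finally have "?J \<le> S k * c" .
        moreover have "H k = (\<lambda>z. - S k * \<phi> z (-\<tau>))"
          unfolding H_def S_def using k True \<rho>(2) by (intro H_term_le_delay) auto
        then have "norm_L2 L (H k) = S k * norm_L2 L (\<lambda>z. \<phi> z (-\<tau>))"
          using S_nonneg[of k] by (simp only: norm_L2_cmult abs_minus_cancel abs_of_nonneg)
        ultimately have "?J + norm_L2 L (H k) \<le> S k * (c + norm_L2 L (\<lambda>z. \<phi> z (-\<tau>)))"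
          by (simp add: distrib_left)
        also have "\<dots> \<le> W (t k) * (c + norm_L2 L (\<lambda>z. \<phi> z (-\<tau>)))"
          using k c_nonneg norm_L2_nonneg by (intro mult_right_mono S_le add_nonneg_nonneg) auto
        finally have "\<bar>b\<bar> * (?J + norm_L2 L (H k)) \<le> \<bar>b\<bar> * (W (t k) * (c + norm_L2 L (\<lambda>z. \<phi> z (-\<tau>))))"
          by (intro mult_left_mono) auto
        then show ?thesis
          using True by (simp add: \<Lambda>_def y_def distrib_left mult.assoc)
      next
        case False
        have "?J = (\<Sum>j = 0..k. \<rho> * A_coeff \<alpha> \<rho> (k - j) * norm_L2 L (u (j - N)))"
          by (simp add: sum_distrib_left gA flip: mult.assoc)
        \<comment> \<open>Levels \<open>j - N \<le> 0\<close> are bounded by \<open>c\<close>. The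
          others lie between 1 and \<open>k - 1\<close>, because \<open>N \<ge> 1\<close>, and are
          bounded by \<open>m\<close>. Adding \<open>m \<ge> 0\<close> throughout lets it collect
          the full weight \<open>S k\<close>.\<close>
        also have "\<dots> \<le> (\<Sum>j = 0..k. \<rho> * A_coeff \<alpha> \<rho> (k - j) * ((if j \<le> N then c else 0) + m))"
        proof (intro sum_mono mult_left_mono)
          fix j assume j: "j \<in> {0..k}"
          show "norm_L2 L (u (j - N)) \<le> (if j \<le> N then c else 0) + m"
            using c[of j] m(1) m(2)[of "j - N"] j assms(9) by auto
        qed (use \<rho>(1) A_nonneg in auto)
        also have "\<dots> = (\<Sum>j = 0..k. if j \<le> N then \<rho> * A_coeff \<alpha> \<rho> (k - j) * c else 0) + S k * m"
        proof -
          have "S k * m = (\<Sum>j = 0..k. \<rho> * A_coeff \<alpha> \<rho> (k - j) * m)"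
            by (simp add: S_def sum_distrib_left sum_distrib_right gA)
          then show ?thesis
            by (simp only: flip: sum.distrib) (intro sum.cong, auto simp: distrib_left)
        qed
        also have "(\<Sum>j = 0..k. if j \<le> N then \<rho> * A_coeff \<alpha> \<rho> (k - j) * c else 0)
            = (\<Sum>j\<in>{0..k} \<inter> {j. j \<le> N}. \<rho> * A_coeff \<alpha> \<rho> (k - j) * c)"
          by (subst sum.inter_restrict) auto
        \<comment> \<open>If \<open>k < N\<close>, the terms added have a negative argument, where
          \<open>A_coeff\<close> is 0.\<close>
        also have "\<dots> = (\<Sum>j = 0..N. \<rho> * A_coeff \<alpha> \<rho> (k - j) * c)"
          by (intro sum.mono_neutral_left) (auto simp: A_coeff_def)
        also have "\<dots> = c * \<rho> * (\<Sum>j = 0..N. A_coeff \<alpha> \<rho> (k - j))"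
          by (simp add: sum_distrib_left mult_ac)
        finally have J: "?J \<le> c * \<rho> * (\<Sum>j = 0..N. A_coeff \<alpha> \<rho> (k - j)) + S k * m" .
        have "S k \<le> W (t k)" using k by (intro S_le) auto
        also have "\<dots> \<le> W (of_int K * \<tau>)"
          unfolding W_def using k n assms(2) t_le[of k] t_nonneg[of k]
          by (intro add_left_mono divide_right_mono powr_mono2) auto
        finally have "S k * m \<le> W (of_int K * \<tau>) * m"
          using m(1) by (intro mult_right_mono)
        with J have "?J \<le> c * \<rho> * (\<Sum>j = 0..N. A_coeff \<alpha> \<rho> (k - j)) + W (of_int K * \<tau>) * m"
          by linarith
        then have "\<bar>b\<bar> * ?J \<le> \<bar>b\<bar> * (c * \<rho> * (\<Sum>j = 0..N. A_coeff \<alpha> \<rho> (k - j)) + W (of_int K * \<tau>) * m)"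
          by (intro mult_left_mono) auto
        then show ?thesis
          using False by (simp add: \<Lambda>_def y_def distrib_left mult_ac)
      qed
      then show ?thesis using energy[of k] y_le[OF k] k n by auto
    qed

    \<comment> \<open>Gronwall bound and comparison of constants\<close>
    let ?T = "t n powr \<alpha>" and ?E = "mittag_leffler \<alpha>"
    have two: "1 \<le> (2 :: real) powr \<alpha>" "1 \<le> (2 :: real) powr (\<alpha> + 1)"
      using assms(1) by (auto intro!: ge_one_powr_ge_zero)
    have "norm_L2 L (u n) \<le> ?E (\<Lambda> * ?T) * (norm_L2 L (u 0) + ?T / Gamma (1 + \<alpha>) * Y)"
      unfolding t_def
      using frac_diff_gronwall[of \<alpha> \<rho> \<Lambda> Y "\<lambda>k. norm_L2 L (u k)" n] ineq
        assms(1,2) \<rho>(1) \<Lambda>_nonneg Y_nonneg norm_L2_nonneg n by auto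
    \<comment> \<open>The bound just obtained is sharper; the powers of 2 enter by monotonicity, and
      the leading 2 because the Mittag-Leffler value is at least 1.\<close>
    also have "\<dots> \<le> (2 * ?E (2 powr (\<alpha> + 1) * \<Lambda> * ?T)) *
        (norm_L2 L (u 0) + 2 powr \<alpha> * ?T / Gamma (1 + \<alpha>) * Y)"
    proof (intro mult_mono add_left_mono mult_right_mono divide_right_mono)
      have "\<Lambda> * ?T \<le> 2 powr (\<alpha> + 1) * \<Lambda> * ?T"
        using two(2) \<Lambda>_nonneg by (intro mult_right_mono) (auto simp: mult_le_cancel_right1)
      then have "?E (\<Lambda> * ?T) \<le> ?E (2 powr (\<alpha> + 1) * \<Lambda> * ?T)"
        using assms(1,2) \<Lambda>_nonneg by (intro mittag_leffler_mono) auto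
      moreover have "1 \<le> ?E (2 powr (\<alpha> + 1) * \<Lambda> * ?T)"
        using assms(1,2) \<Lambda>_nonneg by (intro mittag_leffler_ge_1) auto
      ultimately show "?E (\<Lambda> * ?T) \<le> 2 * ?E (2 powr (\<alpha> + 1) * \<Lambda> * ?T)"
        and "0 \<le> 2 * ?E (2 powr (\<alpha> + 1) * \<Lambda> * ?T)" by linarith+
      show "?T \<le> 2 powr \<alpha> * ?T"
        using two(1) by (simp add: mult_le_cancel_right1)
    qed (use assms(1) Y_nonneg norm_L2_nonneg in \<open>auto intro!: add_nonneg_nonneg mult_nonneg_nonneg\<close>)
    finally show "norm_L2 L (u n)
      \<le> 2 * mittag_leffler \<alpha> (2 powr (\<alpha> + 1) * (if n \<le> N then 0
             else \<bar>b\<bar> * (\<rho> powr (1 - \<alpha>) + (of_int K * \<tau>) powr (1 - \<alpha>) / Gamma (2 - \<alpha>))) * t n powr \<alpha>)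
         * (norm_L2 L (u 0) + 2 powr \<alpha> * t n powr \<alpha> / Gamma (1 + \<alpha>) * Max ((\<lambda>k. if n \<le> N
                 then \<bar>b\<bar> * (\<rho> powr (1 - \<alpha>) + t k powr (1 - \<alpha>) / Gamma (2 - \<alpha>))
                          * (c + norm_L2 L (\<lambda>z. \<phi> z (-\<tau>)))
                      + norm_L2 L (F k)
                 else c * \<bar>b\<bar> * \<rho> * (\<Sum>j = 0..N. A_coeff \<alpha> \<rho> (k - j))
                      + \<bar>b\<bar> * norm_L2 L (H k) + norm_L2 L (F k)) ` {1..n}))"
      unfolding \<Lambda>_def Y_def y_def W_def .
  qed
qed

end
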